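(* For a bispace $X$ the following are equivalent. (1) The bispace $X$ is bi-$T_D$. (2) The patch of $Sk(X)$ is discrete. (3) Whenever $Y,Z\subseteq X$ are distinct bisubspaces, they induce different biquotients on $\mathsf{b}\Omega_{\mathsf{fin}}(X)$. (4) For every point $x\in X$, the dualization $\mathsf{b}\Omega_{\mathsf{fin}}(i):\mathsf{b}\Omega_{\mathsf{fin}}(X)\to\mathsf{b}\Omega_{\mathsf{fin}}(X\setminus\{x\})$ of the inclusion $i:X\setminus\{x\}\subseteq X$ is not an isomorphism of finitary biframes.
   Context: A bispace is a set $X$ with two topologies $\Omega^+(X),\Omega^-(X)$ (positive and negative opens); its patch is the space $X$ with the topology generated by $\Omega^+(X)\cup\Omega^-(X)$. A bisubspace is a subset with both subspace topologies. $X$ is bi-$T_D$ if every singleton is of the form $U^+\cap U^-\cap (X\setminus V^+)\cap(X\setminus V^-)$ with $U^+,V^+\in\Omega^+(X)$ and $U^-,V^-\in\Omega^-(X)$. $Sk(X)$ (Skula bispace) has the same points as $X$; its positive topology is generated by the positive opens and the negative closed sets of $X$, its negative topology by the negative opens and the positive closed sets of $X$. A biframe is a triple $\mathcal L=(L^+,L^-,L)$ of frames with injective frame maps $e_L^{\pm}:L^{\pm}\to L$ such that every element of $L$ (the main component) is a join of elements $e_L^+(x^+)\wedge e_L^-(x^-)$. A biframe map $(f^+,f^-):\mathcal L\to\mathcal M$ is a pair of frame maps $f^{\pm}:L^{\pm}\to M^{\pm}$ for which there is a (necessarily unique) frame map $f:L\to M$ with $f\circ e_L^{\pm}=e_M^{\pm}\circ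 f^{\pm}$. $\mathsf{b}\Omega_{\mathsf{fin}}(X)$ is the (finitary) biframe $(\Omega^+(X),\Omega^-(X),\Omega_{\mathsf{fin}}(X))$, with $\Omega_{\mathsf{fin}}(X)$ the quotient of the frame coproduct $\Omega^+(X)\oplus\Omega^-(X)$ imposing the inequalities $\ulcorner U^+\urcorner\wedge\ulcorner U^-\urcorner\le\ulcorner V^+\urcorner\vee\ulcorner V^-\urcorner$ whenever $U^+\cap U^-\subseteq V^+\cup V^-$ in $X$. For a bicontinuous map $f:Y\to X$, $\mathsf{b}\Omega_{\mathsf{fin}}(f)$ is the biframe map $(f^{-1},f^{-1})$. The biquotient of $\mathsf{b}\Omega_{\mathsf{fin}}(X)$ induced by a bisubspace $j:Y\subseteq X$ is the quotient determined by the surjective biframe map $\mathsf{b}\Omega_{\mathsf{fin}}(j)=(-\cap Y,-\cap Y):\mathsf{b}\Omega_{\mathsf{fin}}(X)\to\mathsf{b}\Omega_{\mathsf{fin}}(Y)$, i.e. by the congruence on $\Omega_{\mathsf{fin}}(X)$ which is the kernel of its main component $\Omega_{\mathsf{fin}}(X)\to\Omega_{\mathsf{fin}}(Y)$. *)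

theory Defs
  imports "HOL-Analysis.Abstract_Topology" "HOL-Algebra.Complete_Lattice"
begin

section \<open>Bispaces\<close>

record 'a bispace =
  pos_top :: "'a topology"
  neg_top :: "'a topology"

definition bispace :: "'a bispace \<Rightarrow> bool" where
  "bispace X \<longleftrightarrow> topspace (pos_top X) = topspace (neg_top X)"

definition points :: "'a bispace \<Rightarrow> 'a set" where
  "points X = topspace (pos_top X)"

definition patch :: "'a bispace \<Rightarrow> 'a topology" where
  "patch X = topology_generated_by ({U. openin (pos_top X) U} \<union> {U. openin (neg_top X) U})"

definition bisubspace :: "'a bispace \<Rightarrow> 'a set \<Rightarrow> 'a bispace" where
  "bisubspace X Y = \<lparr>pos_top = subtopology (pos_top X) Y, neg_top = subtopology (neg_top X) Y\<rparr>"

definition bicontinuous :: "'b bispace \<Rightarrow> 'a bispace \<Rightarrow> ('b \<Rightarrow> 'a) \<Rightarrow> bool" where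
  "bicontinuous Y X f \<longleftrightarrow>
     continuous_map (pos_top Y) (pos_top X) f \<and> continuous_map (neg_top Y) (neg_top X) f"

definition bi_T_D :: "'a bispace \<Rightarrow> bool" where
  "bi_T_D X \<longleftrightarrow>
     (\<forall>x \<in> points X. \<exists>U V U' V'.
        openin (pos_top X) U \<and> openin (pos_top X) V \<and>
        openin (neg_top X) U' \<and> openin (neg_top X) V' \<and>
        {x} = U \<inter> U' \<inter> (points X - V) \<inter> (points X - V'))"

definition Sk :: "'a bispace \<Rightarrow> 'a bispace" where
  "Sk X =
     \<lparr>pos_top = topology_generated_by ({U. openin (pos_top X) U} \<union> {C. closedin (neg_top X) C}),
      neg_top = topology_generated_by ({U. openin (neg_top X) U} \<union> {C. closedin (pos_top X) C})\<rparr>"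


section \<open>Frames\<close>

locale frame = complete_lattice +
  assumes meet_Sup_distrib:
    "\<lbrakk>a \<in> carrier L; S \<subseteq> carrier L\<rbrakk> \<Longrightarrow> a \<sqinter> \<Squnion>S = \<Squnion>((\<lambda>s. a \<sqinter> s) ` S)"

definition frame_hom :: "'a gorder \<Rightarrow> 'b gorder \<Rightarrow> ('a \<Rightarrow> 'b) set" where
  "frame_hom L M =
     {h \<in> carrier L \<rightarrow> carrier M.
        h \<top>\<^bsub>L\<^esub> = \<top>\<^bsub>M\<^esub> \<and>
        (\<forall>a \<in> carrier L. \<forall>b \<in> carrier L. h (a \<sqinter>\<^bsub>L\<^esub> b) = h a \<sqinter>\<^bsub>M\<^esub> h b) \<and>
        (\<forall>S \<subseteq> carrier L. h (\<Squnion>\<^bsub>L\<^esub> S) = \<Squnion>\<^bsub>M\<^esub> (h ` S))}"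

definition incl_order :: "'a set set \<Rightarrow> 'a set gorder" where
  "incl_order \<C> = \<lparr>carrier = \<C>, eq = (=), le = (\<subseteq>)\<rparr>"

definition opens_frame :: "'a topology \<Rightarrow> 'a set gorder" where
  "opens_frame T = incl_order {U. openin T U}"


subsection \<open>Coproduct\<close>

text \<open>
  The coproduct of two frames consists of the C-ideals on their product: the down-sets closed
  under arbitrary (in particular empty) joins in each of the two coordinates.
\<close>

definition C_ideal :: "'a gorder \<Rightarrow> 'b gorder \<Rightarrow> ('a \<times> 'b) set \<Rightarrow> bool" where
  "C_ideal L M D \<longleftrightarrow>
     D \<subseteq> carrier L \<times> carrier M \<and>
     (\<forall>(a, b) \<in> D. \<forall>a' \<in> carrier L. \<forall>b' \<in> carrier M.
        a' \<sqsubseteq>\<^bsub>L\<^esub> a \<and> b' \<sqsubseteq>\<^bsub>M\<^esub> b \<longrightarrow> (a', b') \<in> D) \<and>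
     (\<forall>S \<subseteq> carrier L. \<forall>b \<in> carrier M. S \<times> {b} \<subseteq> D \<longrightarrow> (\<Squnion>\<^bsub>L\<^esub> S, b) \<in> D) \<and>
     (\<forall>a \<in> carrier L. \<forall>S \<subseteq> carrier M. {a} \<times> S \<subseteq> D \<longrightarrow> (a, \<Squnion>\<^bsub>M\<^esub> S) \<in> D)"

definition frame_coprod :: "'a gorder \<Rightarrow> 'b gorder \<Rightarrow> ('a \<times> 'b) set gorder" where
  "frame_coprod L M = incl_order {D. C_ideal L M D}"

text \<open>
  The coprojections send \<open>a\<close> and \<open>b\<close> to the least C-ideals containing \<open>(a, \<top>)\<close> and \<open>(\<top>, b)\<close>;
  every C-ideal contains the pairs with a bottom coordinate.
\<close>

definition coproj_left :: "'a gorder \<Rightarrow> 'b gorder \<Rightarrow> 'a \<Rightarrow> ('a \<times> 'b) set" where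
  "coproj_left L M a = {(x, y) \<in> carrier L \<times> carrier M. x \<sqsubseteq>\<^bsub>L\<^esub> a \<or> y = \<bottom>\<^bsub>M\<^esub>}"

definition coproj_right :: "'a gorder \<Rightarrow> 'b gorder \<Rightarrow> 'b \<Rightarrow> ('a \<times> 'b) set" where
  "coproj_right L M b = {(x, y) \<in> carrier L \<times> carrier M. y \<sqsubseteq>\<^bsub>M\<^esub> b \<or> x = \<bottom>\<^bsub>L\<^esub>}"


subsection \<open>Quotients\<close>

definition frame_congruence :: "'a gorder \<Rightarrow> ('a \<times> 'a) set \<Rightarrow> bool" where
  "frame_congruence L \<theta> \<longleftrightarrow>
     equiv (carrier L) \<theta> \<and>
     (\<forall>(a, a') \<in> \<theta>. \<forall>(b, b') \<in> \<theta>. (a \<sqinter>\<^bsub>L\<^esub> b, a' \<sqinter>\<^bsub>L\<^esub> b') \<in> \<theta>) \<and>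
     (\<forall>R \<subseteq> \<theta>. (\<Squnion>\<^bsub>L\<^esub> (fst ` R), \<Squnion>\<^bsub>L\<^esub> (snd ` R)) \<in> \<theta>)"

definition quotient_frame :: "'a gorder \<Rightarrow> ('a \<times> 'a) set \<Rightarrow> 'a set gorder" where
  "quotient_frame L \<theta> =
     \<lparr>carrier = carrier L // \<theta>, eq = (=), le = (\<lambda>A B. \<exists>a \<in> A. \<exists>b \<in> B. a \<sqsubseteq>\<^bsub>L\<^esub> b)\<rparr>"

text \<open>The least congruence imposing \<open>a \<le> b\<close>, that is \<open>a \<sqinter> b = a\<close>, for all \<open>(a, b) \<in> R\<close>.\<close>

definition imposed_congruence :: "'a gorder \<Rightarrow> ('a \<times> 'a) set \<Rightarrow> ('a \<times> 'a) set" where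
  "imposed_congruence L R =
     \<Inter> {\<theta>. frame_congruence L \<theta> \<and> (\<forall>(a, b) \<in> R. (a \<sqinter>\<^bsub>L\<^esub> b, a) \<in> \<theta>)}"


section \<open>Biframes\<close>

record ('p, 'n, 'm) biframe =
  pos :: "'p gorder"
  neg :: "'n gorder"
  main :: "'m gorder"
  pos_emb :: "'p \<Rightarrow> 'm"
  neg_emb :: "'n \<Rightarrow> 'm"

definition biframe :: "('p, 'n, 'm) biframe \<Rightarrow> bool" where
  "biframe \<L> \<longleftrightarrow>
     frame (pos \<L>) \<and> frame (neg \<L>) \<and> frame (main \<L>) \<and>
     pos_emb \<L> \<in> frame_hom (pos \<L>) (main \<L>) \<and> inj_on (pos_emb \<L>) (carrier (pos \<L>)) \<and>
     neg_emb \<L> \<in> frame_hom (neg \<L>) (main \<L>) \<and> inj_on (neg_emb \<L>) (carrier (neg \<L>)) \<and>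
     (\<forall>c \<in> carrier (main \<L>). \<exists>S \<subseteq> carrier (pos \<L>) \<times> carrier (neg \<L>).
        c = \<Squnion>\<^bsub>main \<L>\<^esub> ((\<lambda>(a, b). pos_emb \<L> a \<sqinter>\<^bsub>main \<L>\<^esub> neg_emb \<L> b) ` S))"

definition is_main_component ::
  "('p, 'n, 'm) biframe \<Rightarrow> ('q, 'o, 'l) biframe \<Rightarrow> ('p \<Rightarrow> 'q) \<times> ('n \<Rightarrow> 'o) \<Rightarrow> ('m \<Rightarrow> 'l) \<Rightarrow> bool"
  where
  "is_main_component \<L> \<M> f h \<longleftrightarrow>
     h \<in> frame_hom (main \<L>) (main \<M>) \<and>
     (\<forall>a \<in> carrier (pos \<L>). h (pos_emb \<L> a) = pos_emb \<M> (fst f a)) \<and>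
     (\<forall>b \<in> carrier (neg \<L>). h (neg_emb \<L> b) = neg_emb \<M> (snd f b))"

definition biframe_map ::
  "('p, 'n, 'm) biframe \<Rightarrow> ('q, 'o, 'l) biframe \<Rightarrow> ('p \<Rightarrow> 'q) \<times> ('n \<Rightarrow> 'o) \<Rightarrow> bool" where
  "biframe_map \<L> \<M> f \<longleftrightarrow>
     biframe \<L> \<and> biframe \<M> \<and>
     fst f \<in> frame_hom (pos \<L>) (pos \<M>) \<and> snd f \<in> frame_hom (neg \<L>) (neg \<M>) \<and>
     (\<exists>h. is_main_component \<L> \<M> f h)"

text \<open>The main component is unique only as a map on the carrier, whence \<open>extensional\<close>.\<close>

definition main_component ::
  "('p, 'n, 'm) biframe \<Rightarrow> ('q, 'o, 'l) biframe \<Rightarrow> ('p \<Rightarrow> 'q) \<times> ('n \<Rightarrow> 'o) \<Rightarrow> 'm \<Rightarrow> 'l" where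
  "main_component \<L> \<M> f =
     (THE h. h \<in> extensional (carrier (main \<L>)) \<and> is_main_component \<L> \<M> f h)"

definition biframe_iso ::
  "('p, 'n, 'm) biframe \<Rightarrow> ('q, 'o, 'l) biframe \<Rightarrow> ('p \<Rightarrow> 'q) \<times> ('n \<Rightarrow> 'o) \<Rightarrow> bool" where
  "biframe_iso \<L> \<M> f \<longleftrightarrow>
     biframe_map \<L> \<M> f \<and>
     (\<exists>g. biframe_map \<M> \<L> g \<and>
        (\<forall>a \<in> carrier (pos \<L>). fst g (fst f a) = a) \<and>
        (\<forall>a \<in> carrier (pos \<M>). fst f (fst g a) = a) \<and>
        (\<forall>b \<in> carrier (neg \<L>). snd g (snd f b) = b) \<and>
        (\<forall>b \<in> carrier (neg \<M>). snd f (snd g b) = b))"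


section \<open>The finitary biframe of opens\<close>

definition opens_coprod :: "'a bispace \<Rightarrow> ('a set \<times> 'a set) set gorder" where
  "opens_coprod X = frame_coprod (opens_frame (pos_top X)) (opens_frame (neg_top X))"

definition gen_pos :: "'a bispace \<Rightarrow> 'a set \<Rightarrow> ('a set \<times> 'a set) set" where
  "gen_pos X = coproj_left (opens_frame (pos_top X)) (opens_frame (neg_top X))"

definition gen_neg :: "'a bispace \<Rightarrow> 'a set \<Rightarrow> ('a set \<times> 'a set) set" where
  "gen_neg X = coproj_right (opens_frame (pos_top X)) (opens_frame (neg_top X))"

definition fin_relations ::
  "'a bispace \<Rightarrow> (('a set \<times> 'a set) set \<times> ('a set \<times> 'a set) set) set" where
  "fin_relations X =
     {(gen_pos X U \<sqinter>\<^bsub>opens_coprod X\<^esub> gen_neg X U', gen_pos X V \<squnion>\<^bsub>opens_coprod X\<^esub> gen_neg X V')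
      | U U' V V'.
        openin (pos_top X) U \<and> openin (neg_top X) U' \<and>
        openin (pos_top X) V \<and> openin (neg_top X) V' \<and>
        U \<inter> U' \<subseteq> V \<union> V'}"

definition fin_congruence ::
  "'a bispace \<Rightarrow> (('a set \<times> 'a set) set \<times> ('a set \<times> 'a set) set) set" where
  "fin_congruence X = imposed_congruence (opens_coprod X) (fin_relations X)"

definition Omega_fin :: "'a bispace \<Rightarrow> ('a set \<times> 'a set) set set gorder" where
  "Omega_fin X = quotient_frame (opens_coprod X) (fin_congruence X)"

definition bOmega_fin ::
  "'a bispace \<Rightarrow> ('a set, 'a set, ('a set \<times> 'a set) set set) biframe" where
  "bOmega_fin X =
     \<lparr>pos = opens_frame (pos_top X),
      neg = opens_frame (neg_top X),
      main = Omega_fin X,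
      pos_emb = (\<lambda>U. fin_congruence X `` {gen_pos X U}),
      neg_emb = (\<lambda>U. fin_congruence X `` {gen_neg X U})\<rparr>"

definition bOmega_fin_map ::
  "'b bispace \<Rightarrow> ('b \<Rightarrow> 'a) \<Rightarrow> ('a set \<Rightarrow> 'b set) \<times> ('a set \<Rightarrow> 'b set)" where
  "bOmega_fin_map Y f = ((\<lambda>U. f -` U \<inter> points Y), (\<lambda>U. f -` U \<inter> points Y))"

text \<open>The congruence of the biquotient induced by the inclusion of the bisubspace on \<open>Y\<close>.\<close>

definition biquotient ::
  "'a bispace \<Rightarrow> 'a set \<Rightarrow> (('a set \<times> 'a set) set set \<times> ('a set \<times> 'a set) set set) set" where
  "biquotient X Y =
     (let h = main_component (bOmega_fin X) (bOmega_fin (bisubspace X Y))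
                (bOmega_fin_map (bisubspace X Y) id)
      in {(c, d). c \<in> carrier (Omega_fin X) \<and> d \<in> carrier (Omega_fin X) \<and> h c = h d})"


section \<open>Well-definedness\<close>

text \<open>
  \<open>bOmega_fin X\<close> is a biframe, bicontinuous maps induce biframe maps, and a biframe map has exactly
  one main component on the carrier, so that \<open>main_component\<close> denotes it.
\<close>

lemma (in partial_order) sup_eqI:
  assumes "A \<subseteq> carrier L" "x \<in> carrier L" "\<And>a. a \<in> A \<Longrightarrow> a \<sqsubseteq> x"
    "\<And>y. y \<in> carrier L \<Longrightarrow> (\<And>a. a \<in> A \<Longrightarrow> a \<sqsubseteq> y) \<Longrightarrow> x \<sqsubseteq> y"
  shows "\<Squnion>A = x"
proof -
  have l: "least L x (Upper L A)"
  proof (rule least_UpperI)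
    fix y assume "y \<in> Upper L A"
    then have "y \<in> carrier L" "\<And>a. a \<in> A \<Longrightarrow> a \<sqsubseteq> y" using assms(1) by (auto simp: Upper_def)
    then show "x \<sqsubseteq> y" by (rule assms(4))
  qed (use assms in auto)
  have "least L (\<Squnion>A) (Upper L A)"
    unfolding sup_def using l by (rule someI)
  then show ?thesis using l least_unique by blast
qed

lemma (in partial_order) meet_eqI:
  assumes "a \<in> carrier L" "b \<in> carrier L" "x \<in> carrier L" "x \<sqsubseteq> a" "x \<sqsubseteq> b"
    "\<And>y. y \<in> carrier L \<Longrightarrow> y \<sqsubseteq> a \<Longrightarrow> y \<sqsubseteq> b \<Longrightarrow> y \<sqsubseteq> x"
  shows "a \<sqinter> b = x"
proof -
  have l: "greatest L x (Lower L {a, b})"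
    using assms by (intro greatest_LowerI) (auto simp: Lower_def)
  have "greatest L (a \<sqinter> b) (Lower L {a, b})"
    unfolding meet_def inf_def using l by (rule someI)
  then show ?thesis using l greatest_unique by blast
qed

lemma (in partial_order) complete_lattice_by_sups:
  assumes "\<And>A. A \<subseteq> carrier L \<Longrightarrow>
     \<exists>x \<in> carrier L. (\<forall>a \<in> A. a \<sqsubseteq> x) \<and> (\<forall>y \<in> carrier L. (\<forall>a \<in> A. a \<sqsubseteq> y) \<longrightarrow> x \<sqsubseteq> y)"
  shows "complete_lattice L"
proof (rule complete_latticeI)
  fix A assume A: "A \<subseteq> carrier L"
  then show "\<exists>s. least L s (Upper L A)"
  proof -
    from assms[OF A] obtain x where "x \<in> carrier L" "\<forall>a \<in> A. a \<sqsubseteq> x"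
      "\<forall>y \<in> carrier L. (\<forall>a \<in> A. a \<sqsubseteq> y) \<longrightarrow> x \<sqsubseteq> y" by blast
    then have "least L x (Upper L A)"
      using A by (intro least_UpperI) (auto simp: Upper_def subset_iff)
    then show ?thesis ..
  qed
  have "Lower L A \<subseteq> carrier L" by (auto simp: Lower_def)
  from assms[OF this] obtain x where x: "x \<in> carrier L" "\<forall>a \<in> Lower L A. a \<sqsubseteq> x"
     "\<forall>y \<in> carrier L. (\<forall>a \<in> Lower L A. a \<sqsubseteq> y) \<longrightarrow> x \<sqsubseteq> y" by blast
  have "x \<in> Lower L A" using x(1,3) A by (auto simp: Lower_def)
  then show "\<exists>i. greatest L i (Lower L A)"
    using x by (auto simp: greatest_def)
qed

lemma (in partial_order) top_eqI:
  assumes "t \<in> carrier L" "\<And>x. x \<in> carrier L \<Longrightarrow> x \<sqsubseteq> t"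
  shows "\<top> = t"
proof -
  have g: "greatest L t (carrier L)" using assms by (auto simp: greatest_def)
  have "greatest L \<top> (carrier L)" unfolding top_def using g by (rule someI)
  then show ?thesis using g greatest_unique by blast
qed

lemma (in partial_order) bottom_eqI:
  assumes "t \<in> carrier L" "\<And>x. x \<in> carrier L \<Longrightarrow> t \<sqsubseteq> x"
  shows "\<bottom> = t"
proof -
  have g: "least L t (carrier L)" using assms by (auto simp: least_def)
  have "least L \<bottom> (carrier L)" unfolding bottom_def using g by (rule someI)
  then show ?thesis using g least_unique by blast
qed

context frame
begin

lemma sup_mono:
  assumes "A \<subseteq> carrier L" "B \<subseteq> carrier L" "\<And>a. a \<in> A \<Longrightarrow> \<exists>b \<in> B. a \<sqsubseteq> b"
  shows "\<Squnion>A \<sqsubseteq> \<Squnion>B"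
proof (rule sup_least)
  fix a assume "a \<in> A"
  then obtain b where "b \<in> B" "a \<sqsubseteq> b" using assms(3) by blast
  then show "a \<sqsubseteq> \<Squnion>B"
    using assms \<open>a \<in> A\<close> by (meson le_trans sup_upper sup_closed subsetD)
qed (use assms in auto)

lemma meet_mono:
  "\<lbrakk>a \<sqsubseteq> c; b \<sqsubseteq> d; a \<in> carrier L; b \<in> carrier L; c \<in> carrier L; d \<in> carrier L\<rbrakk> \<Longrightarrow> a \<sqinter> b \<sqsubseteq> c \<sqinter> d"
  by (intro meet_le) (auto intro: le_trans meet_left meet_right)

lemma le_iff_meet: "\<lbrakk>a \<in> carrier L; b \<in> carrier L\<rbrakk> \<Longrightarrow> a \<sqsubseteq> b \<longleftrightarrow> a \<sqinter> b = a"
  by (metis meet_eqI le_refl meet_right)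

lemma sup_empty_eq: "\<Squnion>{} = \<bottom>"
  using weak_sup_empty by (simp add: eq_is_equal)

lemma meet_Sup_Sup:
  assumes "A \<subseteq> carrier L" "B \<subseteq> carrier L"
  shows "\<Squnion>A \<sqinter> \<Squnion>B = \<Squnion>((\<lambda>(a, b). a \<sqinter> b) ` (A \<times> B))"
proof -
  have c: "(\<lambda>(a, b). a \<sqinter> b) ` (A \<times> B) \<subseteq> carrier L" using assms by (auto intro!: meet_closed)
  have "\<Squnion>A \<sqinter> \<Squnion>B = \<Squnion>((\<lambda>b. \<Squnion>A \<sqinter> b) ` B)"
    using assms by (intro meet_Sup_distrib) auto
  also have "\<dots> = \<Squnion>((\<lambda>(a, b). a \<sqinter> b) ` (A \<times> B))"
  proof (rule sup_eqI)
    fix x assume "x \<in> (\<lambda>b. \<Squnion>A \<sqinter> b) ` B"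
    then obtain b where b: "b \<in> B" "x = \<Squnion>A \<sqinter> b" by auto
    then have "x = \<Squnion>((\<lambda>a. b \<sqinter> a) ` A)"
      using assms meet_Sup_distrib[of b A] by (auto simp: meet_comm)
    also have "\<dots> \<sqsubseteq> \<Squnion>((\<lambda>(a, b). a \<sqinter> b) ` (A \<times> B))"
      using assms b c by (intro sup_least sup_closed) (force simp: meet_comm intro!: sup_upper)+
    finally show "x \<sqsubseteq> \<Squnion>((\<lambda>(a, b). a \<sqinter> b) ` (A \<times> B))" .
  next
    fix y assume y: "y \<in> carrier L" "\<And>x. x \<in> (\<lambda>b. \<Squnion>A \<sqinter> b) ` B \<Longrightarrow> x \<sqsubseteq> y"
    show "\<Squnion>((\<lambda>(a, b). a \<sqinter> b) ` (A \<times> B)) \<sqsubseteq> y"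
    proof (rule sup_least[OF c y(1)])
      fix x assume "x \<in> (\<lambda>(a, b). a \<sqinter> b) ` (A \<times> B)"
      then obtain a b where ab: "a \<in> A" "b \<in> B" "x = a \<sqinter> b" by auto
      have "a \<sqinter> b \<sqsubseteq> \<Squnion>A \<sqinter> b" using ab assms by (intro meet_mono sup_upper sup_closed) auto
      moreover have "\<Squnion>A \<sqinter> b \<sqsubseteq> y" using y(2) ab by auto
      ultimately show "x \<sqsubseteq> y" using ab y(1) assms
        by (blast intro: le_trans[of _ "\<Squnion>A \<sqinter> b"] meet_closed sup_closed)
    qed
  qed (use assms c in auto)
  finally show ?thesis .
qed

lemma meet_image_closed:
  "\<lbrakk>A \<subseteq> carrier L; B \<subseteq> carrier L\<rbrakk> \<Longrightarrow> (\<lambda>(a, b). a \<sqinter> b) ` (A \<times> B) \<subseteq> carrier L"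
  by (auto intro!: meet_closed)

lemma meet_interchange:
  assumes "a \<in> carrier L" "b \<in> carrier L" "c \<in> carrier L" "d \<in> carrier L"
  shows "(a \<sqinter> b) \<sqinter> (c \<sqinter> d) = (a \<sqinter> c) \<sqinter> (b \<sqinter> d)"
proof -
  have "b \<sqinter> (c \<sqinter> d) = (b \<sqinter> c) \<sqinter> d" using assms by (simp add: meet_assoc)
  also have "\<dots> = (c \<sqinter> b) \<sqinter> d" by (simp add: meet_comm[of L b c])
  also have "\<dots> = c \<sqinter> (b \<sqinter> d)" using assms by (simp add: meet_assoc)
  finally show ?thesis using assms by (simp add: meet_assoc)
qed

lemma sup_UN:
  assumes "\<And>i. i \<in> I \<Longrightarrow> F i \<subseteq> carrier L"
  shows "\<Squnion>((\<lambda>i. \<Squnion>(F i)) ` I) = \<Squnion>(\<Union>i\<in>I. F i)"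
proof (rule sup_eqI)
  show "\<And>a. a \<in> (\<lambda>i. \<Squnion> F i) ` I \<Longrightarrow> a \<sqsubseteq> \<Squnion> (\<Union> (F ` I))"
    using assms by (clarsimp, intro sup_least) (blast intro: sup_upper sup_closed)+
  fix y assume y: "y \<in> carrier L" "\<And>a. a \<in> (\<lambda>i. \<Squnion> F i) ` I \<Longrightarrow> a \<sqsubseteq> y"
  show "\<Squnion> (\<Union> (F ` I)) \<sqsubseteq> y"
  proof (rule sup_least)
    fix x assume "x \<in> \<Union> (F ` I)"
    then obtain i where i: "i \<in> I" "x \<in> F i" by auto
    then have "x \<sqsubseteq> \<Squnion>(F i)" using assms by (intro sup_upper) auto
    moreover have "\<Squnion>(F i) \<sqsubseteq> y" using y(2) i by auto
    ultimately show "x \<sqsubseteq> y" using i y assms by (meson le_trans sup_closed subsetD)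
  qed (use assms y in auto)
qed (use assms in \<open>auto intro!: sup_closed simp: image_subset_iff\<close>)

end

lemma frame_homD:
  assumes "h \<in> frame_hom L M"
  shows "h \<in> carrier L \<rightarrow> carrier M" "h \<top>\<^bsub>L\<^esub> = \<top>\<^bsub>M\<^esub>"
    "\<lbrakk>a \<in> carrier L; b \<in> carrier L\<rbrakk> \<Longrightarrow> h (a \<sqinter>\<^bsub>L\<^esub> b) = h a \<sqinter>\<^bsub>M\<^esub> h b"
    "S \<subseteq> carrier L \<Longrightarrow> h (\<Squnion>\<^bsub>L\<^esub> S) = \<Squnion>\<^bsub>M\<^esub> (h ` S)"
  using assms by (auto simp: frame_hom_def)

lemma frame_hom_mono:
  assumes "frame L" "frame M" "h \<in> frame_hom L M" "a \<in> carrier L" "b \<in> carrier L" "a \<sqsubseteq>\<^bsub>L\<^esub> b"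
  shows "h a \<sqsubseteq>\<^bsub>M\<^esub> h b"
proof -
  interpret L: frame L by fact
  interpret M: frame M by fact
  have "h a \<in> carrier M" "h b \<in> carrier M" using frame_homD(1)[OF assms(3)] assms(4,5) by auto
  then show ?thesis using assms L.le_iff_meet M.le_iff_meet frame_homD(3) by metis
qed

lemma frame_hom_comp:
  assumes "f \<in> frame_hom L M" "g \<in> frame_hom M N"
  shows "(\<lambda>x. g (f x)) \<in> frame_hom L N"
proof -
  have m: "f \<in> carrier L \<rightarrow> carrier M" "g \<in> carrier M \<rightarrow> carrier N"
    using assms by (auto simp: frame_hom_def)
  moreover have "g (f (\<Squnion>\<^bsub>L\<^esub> S)) = \<Squnion>\<^bsub>N\<^esub> ((\<lambda>x. g (f x)) ` S)" if "S \<subseteq> carrier L" for S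
  proof -
    have "f ` S \<subseteq> carrier M" using m that by auto
    then show ?thesis using assms that by (simp add: frame_homD image_image)
  qed
  moreover have "g (f \<top>\<^bsub>L\<^esub>) = \<top>\<^bsub>N\<^esub>" using assms by (simp add: frame_homD)
  moreover have "g (f (a \<sqinter>\<^bsub>L\<^esub> b)) = g (f a) \<sqinter>\<^bsub>N\<^esub> g (f b)" if "a \<in> carrier L" "b \<in> carrier L" for a b
    using m that by (simp add: frame_homD(3)[OF assms(1)] frame_homD(3)[OF assms(2)] Pi_iff)
  ultimately show ?thesis
    unfolding frame_hom_def by blast
qed


subsection \<open>Frames of sets\<close>

lemma incl_order_simps [simp]:
  "carrier (incl_order \<C>) = \<C>" "eq (incl_order \<C>) = (=)" "le (incl_order \<C>) = (\<subseteq>)"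
  by (auto simp: incl_order_def)

lemma partial_order_incl: "partial_order (incl_order \<C>)"
  by unfold_locales auto

lemma opens_frame_simps [simp]:
  "carrier (opens_frame T) = {U. openin T U}" "eq (opens_frame T) = (=)" "le (opens_frame T) = (\<subseteq>)"
  by (auto simp: opens_frame_def)

lemma opens_frame_sup:
  assumes "S \<subseteq> {U. openin T U}" shows "\<Squnion>\<^bsub>opens_frame T\<^esub> S = \<Union>S"
  unfolding opens_frame_def using assms
  by (intro partial_order.sup_eqI partial_order_incl) auto

lemma opens_frame_meet:
  "\<lbrakk>openin T U; openin T V\<rbrakk> \<Longrightarrow> U \<sqinter>\<^bsub>opens_frame T\<^esub> V = U \<inter> V"
  unfolding opens_frame_def
  by (intro partial_order.meet_eqI partial_order_incl) auto

lemma frame_opens: "frame (opens_frame T)"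
proof -
  interpret partial_order "opens_frame T" unfolding opens_frame_def by (rule partial_order_incl)
  have "complete_lattice (opens_frame T)"
  proof (rule complete_lattice_by_sups)
    fix A assume A: "A \<subseteq> carrier (opens_frame T)"
    show "\<exists>x\<in>carrier (opens_frame T). (\<forall>a\<in>A. a \<sqsubseteq>\<^bsub>opens_frame T\<^esub> x) \<and>
        (\<forall>y\<in>carrier (opens_frame T). (\<forall>a\<in>A. a \<sqsubseteq>\<^bsub>opens_frame T\<^esub> y) \<longrightarrow> x \<sqsubseteq>\<^bsub>opens_frame T\<^esub> y)"
      using A by (intro bexI[of _ "\<Union>A"]) auto
  qed
  then interpret complete_lattice "opens_frame T" .
  show ?thesis
  proof unfold_locales
    fix U S assume "U \<in> carrier (opens_frame T)" "S \<subseteq> carrier (opens_frame T)"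
    then have US: "openin T U" "S \<subseteq> {U. openin T U}" by auto
    have im: "(\<lambda>s. U \<sqinter>\<^bsub>opens_frame T\<^esub> s) ` S = (\<lambda>s. U \<inter> s) ` S"
      using US by (intro image_cong) (auto simp: opens_frame_meet)
    have sub: "(\<lambda>s. U \<inter> s) ` S \<subseteq> {U. openin T U}" using US by auto
    show "U \<sqinter>\<^bsub>opens_frame T\<^esub> \<Squnion>\<^bsub>opens_frame T\<^esub> S = \<Squnion>\<^bsub>opens_frame T\<^esub> ((\<lambda>s. U \<sqinter>\<^bsub>opens_frame T\<^esub> s) ` S)"
    proof -
      have "openin T (\<Union>S)" using US by (blast intro: openin_Union)
      moreover have "U \<inter> \<Union>S = \<Union>((\<lambda>s. U \<inter> s) ` S)" by blast
      ultimately show ?thesis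
        using opens_frame_meet[OF US(1)] opens_frame_sup[OF US(2)] opens_frame_sup[OF sub] im by metis
    qed
  qed
qed

lemma opens_frame_top: "\<top>\<^bsub>opens_frame T\<^esub> = topspace T"
proof -
  interpret frame "opens_frame T" by (rule frame_opens)
  show ?thesis by (rule top_eqI) (auto simp: openin_subset)
qed

lemma opens_frame_bot: "\<bottom>\<^bsub>opens_frame T\<^esub> = {}"
proof -
  interpret frame "opens_frame T" by (rule frame_opens)
  show ?thesis by (rule bottom_eqI) auto
qed


lemma frame_cong_meet_Sup_le:
  assumes "partial_order L" and
   "\<And>A. A \<subseteq> carrier L \<Longrightarrow>
     \<exists>x \<in> carrier L. (\<forall>a \<in> A. a \<sqsubseteq>\<^bsub>L\<^esub> x) \<and> (\<forall>y \<in> carrier L. (\<forall>a \<in> A. a \<sqsubseteq>\<^bsub>L\<^esub> y) \<longrightarrow> x \<sqsubseteq>\<^bsub>L\<^esub> y)"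
   and le: "\<And>a S. \<lbrakk>a \<in> carrier L; S \<subseteq> carrier L\<rbrakk> \<Longrightarrow>
     a \<sqinter>\<^bsub>L\<^esub> \<Squnion>\<^bsub>L\<^esub> S \<sqsubseteq>\<^bsub>L\<^esub> \<Squnion>\<^bsub>L\<^esub>((\<lambda>s. a \<sqinter>\<^bsub>L\<^esub> s) ` S)"
  shows "frame L"
proof -
  interpret partial_order L by fact
  interpret complete_lattice L by (rule complete_lattice_by_sups) (rule assms(2))
  show ?thesis
  proof unfold_locales
    fix a S assume aS: "a \<in> carrier L" "S \<subseteq> carrier L"
    then have c: "(\<lambda>s. a \<sqinter>\<^bsub>L\<^esub> s) ` S \<subseteq> carrier L" by (auto intro!: meet_closed)
    have "\<Squnion>\<^bsub>L\<^esub>((\<lambda>s. a \<sqinter>\<^bsub>L\<^esub> s) ` S) \<sqsubseteq>\<^bsub>L\<^esub> a \<sqinter>\<^bsub>L\<^esub> \<Squnion>\<^bsub>L\<^esub> S"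
    proof (rule sup_least[OF c])
      fix x assume "x \<in> (\<lambda>s. a \<sqinter>\<^bsub>L\<^esub> s) ` S"
      then obtain s where s: "s \<in> S" "x = a \<sqinter>\<^bsub>L\<^esub> s" by auto
      then have sc: "s \<in> carrier L" using aS by auto
      have "a \<sqinter>\<^bsub>L\<^esub> s \<sqsubseteq>\<^bsub>L\<^esub> \<Squnion>\<^bsub>L\<^esub> S"
        using le_trans[OF meet_right[OF aS(1) sc] sup_upper[OF aS(2) s(1)]] aS sc by auto
      then show "x \<sqsubseteq>\<^bsub>L\<^esub> a \<sqinter>\<^bsub>L\<^esub> \<Squnion>\<^bsub>L\<^esub> S"
        unfolding s using aS sc by (intro meet_le meet_left) auto
    qed (use aS in auto)
    then show "a \<sqinter>\<^bsub>L\<^esub> \<Squnion>\<^bsub>L\<^esub> S = \<Squnion>\<^bsub>L\<^esub>((\<lambda>s. a \<sqinter>\<^bsub>L\<^esub> s) ` S)"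
      using le[OF aS] aS c by (intro le_antisym) auto
  qed
qed

subsection \<open>The coproduct\<close>

lemma coprod_simps [simp]:
  "carrier (frame_coprod L M) = {D. C_ideal L M D}" "eq (frame_coprod L M) = (=)"
  "le (frame_coprod L M) = (\<subseteq>)"
  by (auto simp: frame_coprod_def)

lemma C_idealD:
  assumes "C_ideal L M D"
  shows "D \<subseteq> carrier L \<times> carrier M"
    "\<lbrakk>(a, b) \<in> D; a' \<in> carrier L; b' \<in> carrier M; a' \<sqsubseteq>\<^bsub>L\<^esub> a; b' \<sqsubseteq>\<^bsub>M\<^esub> b\<rbrakk> \<Longrightarrow> (a', b') \<in> D"
    "\<lbrakk>S \<subseteq> carrier L; b \<in> carrier M; \<And>s. s \<in> S \<Longrightarrow> (s, b) \<in> D\<rbrakk> \<Longrightarrow> (\<Squnion>\<^bsub>L\<^esub> S, b) \<in> D"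
    "\<lbrakk>a \<in> carrier L; T \<subseteq> carrier M; \<And>s. s \<in> T \<Longrightarrow> (a, s) \<in> D\<rbrakk> \<Longrightarrow> (a, \<Squnion>\<^bsub>M\<^esub> T) \<in> D"
proof -
  have D: "D \<subseteq> carrier L \<times> carrier M"
     "\<forall>(a, b) \<in> D. \<forall>a' \<in> carrier L. \<forall>b' \<in> carrier M. a' \<sqsubseteq>\<^bsub>L\<^esub> a \<and> b' \<sqsubseteq>\<^bsub>M\<^esub> b \<longrightarrow> (a', b') \<in> D"
     "\<forall>S \<subseteq> carrier L. \<forall>b \<in> carrier M. S \<times> {b} \<subseteq> D \<longrightarrow> (\<Squnion>\<^bsub>L\<^esub> S, b) \<in> D"
     "\<forall>a \<in> carrier L. \<forall>S \<subseteq> carrier M. {a} \<times> S \<subseteq> D \<longrightarrow> (a, \<Squnion>\<^bsub>M\<^esub> S) \<in> D"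
    using assms unfolding C_ideal_def by - (elim conjE, assumption)+
  show "D \<subseteq> carrier L \<times> carrier M" by (rule D(1))
  show "(a', b') \<in> D" if "(a, b) \<in> D" "a' \<in> carrier L" "b' \<in> carrier M" "a' \<sqsubseteq>\<^bsub>L\<^esub> a" "b' \<sqsubseteq>\<^bsub>M\<^esub> b"
    using D(2) that by blast
  show "(\<Squnion>\<^bsub>L\<^esub> S, b) \<in> D" if "S \<subseteq> carrier L" "b \<in> carrier M" "\<And>s. s \<in> S \<Longrightarrow> (s, b) \<in> D"
  proof -
    have "S \<times> {b} \<subseteq> D" using that(3) by auto
    then show ?thesis using D(3) that(1,2) by blast
  qed
  show "(a, \<Squnion>\<^bsub>M\<^esub> T) \<in> D" if "a \<in> carrier L" "T \<subseteq> carrier M" "\<And>s. s \<in> T \<Longrightarrow> (a, s) \<in> D"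
  proof -
    have "{a} \<times> T \<subseteq> D" using that(3) by auto
    then show ?thesis using D(4) that(1,2) by blast
  qed
qed

lemma C_idealI:
  assumes "D \<subseteq> carrier L \<times> carrier M"
    "\<And>a b a' b'. \<lbrakk>(a, b) \<in> D; a' \<in> carrier L; b' \<in> carrier M; a' \<sqsubseteq>\<^bsub>L\<^esub> a; b' \<sqsubseteq>\<^bsub>M\<^esub> b\<rbrakk> \<Longrightarrow> (a', b') \<in> D"
    "\<And>S b. \<lbrakk>S \<subseteq> carrier L; b \<in> carrier M; \<And>s. s \<in> S \<Longrightarrow> (s, b) \<in> D\<rbrakk> \<Longrightarrow> (\<Squnion>\<^bsub>L\<^esub> S, b) \<in> D"
    "\<And>a S. \<lbrakk>a \<in> carrier L; S \<subseteq> carrier M; \<And>s. s \<in> S \<Longrightarrow> (a, s) \<in> D\<rbrakk> \<Longrightarrow> (a, \<Squnion>\<^bsub>M\<^esub> S) \<in> D"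
  shows "C_ideal L M D"
  unfolding C_ideal_def
proof (intro conjI)
  show "D \<subseteq> carrier L \<times> carrier M" by fact
  show "\<forall>(a, b)\<in>D. \<forall>a'\<in>carrier L. \<forall>b'\<in>carrier M. a' \<sqsubseteq>\<^bsub>L\<^esub> a \<and> b' \<sqsubseteq>\<^bsub>M\<^esub> b \<longrightarrow> (a', b') \<in> D"
    using assms(2) by blast
  show "\<forall>S\<subseteq>carrier L. \<forall>b\<in>carrier M. S \<times> {b} \<subseteq> D \<longrightarrow> (\<Squnion>\<^bsub>L\<^esub> S, b) \<in> D"
    by (intro allI ballI impI assms(3)) auto
  show "\<forall>a\<in>carrier L. \<forall>S\<subseteq>carrier M. {a} \<times> S \<subseteq> D \<longrightarrow> (a, \<Squnion>\<^bsub>M\<^esub> S) \<in> D"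
    by (intro allI ballI impI assms(4)) auto
qed

locale two_frames = L: frame L + M: frame M for L :: "'a gorder" and M :: "'b gorder"
begin

abbreviation C where "C \<equiv> frame_coprod L M"

lemma C_ideal_all: "C_ideal L M (carrier L \<times> carrier M)"
  by (rule C_idealI) auto

lemma C_ideal_Inter:
  assumes "\<And>D. D \<in> F \<Longrightarrow> C_ideal L M D" "F \<noteq> {}"
  shows "C_ideal L M (\<Inter>F)"
proof (rule C_idealI)
  show "\<Inter>F \<subseteq> carrier L \<times> carrier M" using assms C_idealD(1) by blast
  show "(a', b') \<in> \<Inter>F" if "(a, b) \<in> \<Inter>F" "a' \<in> carrier L" "b' \<in> carrier M" "a' \<sqsubseteq>\<^bsub>L\<^esub> a" "b' \<sqsubseteq>\<^bsub>M\<^esub> b" for a b a' b'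
    using that C_idealD(2)[OF assms(1)] by blast
  show "(\<Squnion>\<^bsub>L\<^esub> S, b) \<in> \<Inter>F" if "S \<subseteq> carrier L" "b \<in> carrier M" "\<And>s. s \<in> S \<Longrightarrow> (s, b) \<in> \<Inter>F" for S b
    using that by (auto intro!: C_idealD(3)[OF assms(1)])
  show "(a, \<Squnion>\<^bsub>M\<^esub> S) \<in> \<Inter>F" if "a \<in> carrier L" "S \<subseteq> carrier M" "\<And>s. s \<in> S \<Longrightarrow> (a, s) \<in> \<Inter>F" for S a
    using that by (auto intro!: C_idealD(4)[OF assms(1)])
qed

lemma C_ideal_Int: "\<lbrakk>C_ideal L M D; C_ideal L M E\<rbrakk> \<Longrightarrow> C_ideal L M (D \<inter> E)"
  using C_ideal_Inter[of "{D, E}"] by auto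

lemma partial_order_coprod: "partial_order C"
  unfolding frame_coprod_def by (rule partial_order_incl)

lemma coprod_meet: "\<lbrakk>C_ideal L M D; C_ideal L M E\<rbrakk> \<Longrightarrow> D \<sqinter>\<^bsub>C\<^esub> E = D \<inter> E"
  by (intro partial_order.meet_eqI[OF partial_order_coprod]) (auto intro: C_ideal_Int)

definition cgen where "cgen A = \<Inter>{D. C_ideal L M D \<and> A \<subseteq> D}"

lemma C_ideal_cgen: "A \<subseteq> carrier L \<times> carrier M \<Longrightarrow> C_ideal L M (cgen A)"
  unfolding cgen_def using C_ideal_all by (intro C_ideal_Inter) auto

lemma cgen_upper: "A \<subseteq> cgen A" by (auto simp: cgen_def)

lemma cgen_least: "\<lbrakk>C_ideal L M D; A \<subseteq> D\<rbrakk> \<Longrightarrow> cgen A \<subseteq> D" by (auto simp: cgen_def)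

lemma Union_carrier: "S \<subseteq> {D. C_ideal L M D} \<Longrightarrow> \<Union>S \<subseteq> carrier L \<times> carrier M"
  using C_idealD(1) by blast

lemma coprod_sup:
  assumes "S \<subseteq> {D. C_ideal L M D}" shows "\<Squnion>\<^bsub>C\<^esub> S = cgen (\<Union>S)"
proof (rule partial_order.sup_eqI[OF partial_order_coprod])
  show "cgen (\<Union>S) \<in> carrier C" using Union_carrier[OF assms] C_ideal_cgen by simp
  show "a \<sqsubseteq>\<^bsub>C\<^esub> cgen (\<Union>S)" if "a \<in> S" for a using that cgen_upper[of "\<Union>S"] by auto
  show "cgen (\<Union>S) \<sqsubseteq>\<^bsub>C\<^esub> y" if "y \<in> carrier C" "\<And>a. a \<in> S \<Longrightarrow> a \<sqsubseteq>\<^bsub>C\<^esub> y" for y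
    using that by (simp, intro cgen_least) auto
qed (use assms in simp)

lemma C_ideal_shift:
  assumes "C_ideal L M D" "u \<in> carrier L" "v \<in> carrier M"
  shows "C_ideal L M {(x, y) \<in> carrier L \<times> carrier M. (x \<sqinter>\<^bsub>L\<^esub> u, y \<sqinter>\<^bsub>M\<^esub> v) \<in> D}"
proof (rule C_idealI)
  fix S b assume S: "S \<subseteq> carrier L" "b \<in> carrier M"
    "\<And>s. s \<in> S \<Longrightarrow> (s, b) \<in> {(x, y) \<in> carrier L \<times> carrier M. (x \<sqinter>\<^bsub>L\<^esub> u, y \<sqinter>\<^bsub>M\<^esub> v) \<in> D}"
  have "\<Squnion>\<^bsub>L\<^esub> S \<sqinter>\<^bsub>L\<^esub> u = \<Squnion>\<^bsub>L\<^esub> ((\<lambda>s. u \<sqinter>\<^bsub>L\<^esub> s) ` S)"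
    using L.meet_Sup_distrib[OF assms(2) S(1)] meet_comm by metis
  moreover have "(\<Squnion>\<^bsub>L\<^esub> ((\<lambda>s. u \<sqinter>\<^bsub>L\<^esub> s) ` S), b \<sqinter>\<^bsub>M\<^esub> v) \<in> D"
    using S assms(2,3) by (intro C_idealD(3)[OF assms(1)]) (auto simp: meet_comm[of L u])
  ultimately show "(\<Squnion>\<^bsub>L\<^esub> S, b) \<in> {(x, y) \<in> carrier L \<times> carrier M. (x \<sqinter>\<^bsub>L\<^esub> u, y \<sqinter>\<^bsub>M\<^esub> v) \<in> D}"
    using S by simp
next
  fix a S assume S: "a \<in> carrier L" "S \<subseteq> carrier M"
    "\<And>s. s \<in> S \<Longrightarrow> (a, s) \<in> {(x, y) \<in> carrier L \<times> carrier M. (x \<sqinter>\<^bsub>L\<^esub> u, y \<sqinter>\<^bsub>M\<^esub> v) \<in> D}"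
  have "\<Squnion>\<^bsub>M\<^esub> S \<sqinter>\<^bsub>M\<^esub> v = \<Squnion>\<^bsub>M\<^esub> ((\<lambda>s. v \<sqinter>\<^bsub>M\<^esub> s) ` S)"
    using M.meet_Sup_distrib[OF assms(3) S(2)] meet_comm by metis
  moreover have "(a \<sqinter>\<^bsub>L\<^esub> u, \<Squnion>\<^bsub>M\<^esub> ((\<lambda>s. v \<sqinter>\<^bsub>M\<^esub> s) ` S)) \<in> D"
    using S assms(2,3) by (intro C_idealD(4)[OF assms(1)]) (auto simp: meet_comm[of M v])
  ultimately show "(a, \<Squnion>\<^bsub>M\<^esub> S) \<in> {(x, y) \<in> carrier L \<times> carrier M. (x \<sqinter>\<^bsub>L\<^esub> u, y \<sqinter>\<^bsub>M\<^esub> v) \<in> D}"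
    using S by simp
next
  fix a b a' b'
  assume h: "(a, b) \<in> {(x, y) \<in> carrier L \<times> carrier M. (x \<sqinter>\<^bsub>L\<^esub> u, y \<sqinter>\<^bsub>M\<^esub> v) \<in> D}"
    "a' \<in> carrier L" "b' \<in> carrier M" "a' \<sqsubseteq>\<^bsub>L\<^esub> a" "b' \<sqsubseteq>\<^bsub>M\<^esub> b"
  have "(a' \<sqinter>\<^bsub>L\<^esub> u, b' \<sqinter>\<^bsub>M\<^esub> v) \<in> D"
    by (rule C_idealD(2)[OF assms(1), of "a \<sqinter>\<^bsub>L\<^esub> u" "b \<sqinter>\<^bsub>M\<^esub> v"])
       (use h assms in \<open>auto intro!: L.meet_mono M.meet_mono\<close>)
  then show "(a', b') \<in> {(x, y) \<in> carrier L \<times> carrier M. (x \<sqinter>\<^bsub>L\<^esub> u, y \<sqinter>\<^bsub>M\<^esub> v) \<in> D}"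
    using h by simp
qed (rule subsetI, blast)

lemma L_meet_idem: "x \<in> carrier L \<Longrightarrow> x \<sqinter>\<^bsub>L\<^esub> x = x" using L.le_iff_meet[of x x] by simp
lemma M_meet_idem: "x \<in> carrier M \<Longrightarrow> x \<sqinter>\<^bsub>M\<^esub> x = x" using M.le_iff_meet[of x x] by simp

lemma frame_coprod: "frame C"
proof (rule frame_cong_meet_Sup_le[OF partial_order_coprod])
  fix A assume A: "A \<subseteq> carrier C"
  show "\<exists>x\<in>carrier C. (\<forall>a\<in>A. a \<sqsubseteq>\<^bsub>C\<^esub> x) \<and> (\<forall>y\<in>carrier C. (\<forall>a\<in>A. a \<sqsubseteq>\<^bsub>C\<^esub> y) \<longrightarrow> x \<sqsubseteq>\<^bsub>C\<^esub> y)"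
  proof (intro bexI[of _ "cgen (\<Union>A)"] conjI ballI impI)
    show "cgen (\<Union>A) \<in> carrier C" using A Union_carrier[of A] C_ideal_cgen by simp
    show "a \<sqsubseteq>\<^bsub>C\<^esub> cgen (\<Union>A)" if "a \<in> A" for a using that cgen_upper[of "\<Union>A"] by auto
    show "cgen (\<Union>A) \<sqsubseteq>\<^bsub>C\<^esub> y" if "y \<in> carrier C" "\<forall>a\<in>A. a \<sqsubseteq>\<^bsub>C\<^esub> y" for y
      using that by (simp, intro cgen_least) auto
  qed
next
  fix D S assume "D \<in> carrier C" and "S \<subseteq> carrier C"
  then have D: "C_ideal L M D" and S: "S \<subseteq> {D. C_ideal L M D}" by auto
  have eq: "(\<lambda>s. D \<sqinter>\<^bsub>C\<^esub> s) ` S = (\<lambda>s. D \<inter> s) ` S"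
    using D S by (intro image_cong refl coprod_meet) auto
  have sub: "(\<lambda>s. D \<inter> s) ` S \<subseteq> {D. C_ideal L M D}" using D S C_ideal_Int by auto
  define J where "J = cgen (\<Union>((\<lambda>s. D \<inter> s) ` S))"
  have J: "C_ideal L M J" unfolding J_def by (rule C_ideal_cgen[OF Union_carrier[OF sub]])
  have HS: "C_ideal L M (cgen (\<Union>S))" by (rule C_ideal_cgen[OF Union_carrier[OF S]])
  have "D \<inter> cgen (\<Union>S) \<subseteq> J"
  proof clarify
    fix x y assume xy: "(x, y) \<in> D" "(x, y) \<in> cgen (\<Union>S)"
    have c: "x \<in> carrier L" "y \<in> carrier M" using xy(1) C_idealD(1)[OF D] by auto
    have "cgen (\<Union>S) \<subseteq> {(a, b) \<in> carrier L \<times> carrier M. (a \<sqinter>\<^bsub>L\<^esub> x, b \<sqinter>\<^bsub>M\<^esub> y) \<in> J}"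
    proof (rule cgen_least[OF C_ideal_shift[OF J c]], rule subsetI)
      fix p assume "p \<in> \<Union>S"
      then obtain a b s where p: "p = (a, b)" and s: "(a, b) \<in> s" "s \<in> S" by (cases p) auto
      then have cs: "C_ideal L M s" using S by auto
      then have ab: "a \<in> carrier L" "b \<in> carrier M" using s C_idealD(1)[OF cs] by auto
      have "(a \<sqinter>\<^bsub>L\<^esub> x, b \<sqinter>\<^bsub>M\<^esub> y) \<in> s"
        using ab c by (intro C_idealD(2)[OF cs s(1)]) (auto intro: L.meet_left M.meet_left)
      moreover have "(a \<sqinter>\<^bsub>L\<^esub> x, b \<sqinter>\<^bsub>M\<^esub> y) \<in> D"
        using ab c by (intro C_idealD(2)[OF D xy(1)]) (auto intro: L.meet_right M.meet_right)
      ultimately have "(a \<sqinter>\<^bsub>L\<^esub> x, b \<sqinter>\<^bsub>M\<^esub> y) \<in> J"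
        using s(2) subsetD[OF cgen_upper[of "\<Union>((\<lambda>s. D \<inter> s) ` S)"]] unfolding J_def by blast
      then show "p \<in> {(a, b) \<in> carrier L \<times> carrier M. (a \<sqinter>\<^bsub>L\<^esub> x, b \<sqinter>\<^bsub>M\<^esub> y) \<in> J}" using ab p by simp
    qed
    then have "(x \<sqinter>\<^bsub>L\<^esub> x, y \<sqinter>\<^bsub>M\<^esub> y) \<in> J" using xy(2) by auto
    then show "(x, y) \<in> J" using c by (simp add: L_meet_idem M_meet_idem)
  qed
  then show "D \<sqinter>\<^bsub>C\<^esub> \<Squnion>\<^bsub>C\<^esub> S \<sqsubseteq>\<^bsub>C\<^esub> \<Squnion>\<^bsub>C\<^esub> ((\<lambda>s. D \<sqinter>\<^bsub>C\<^esub> s) ` S)"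
    unfolding eq coprod_sup[OF S] coprod_sup[OF sub] coprod_meet[OF D HS] J_def by simp
qed

lemma coprod_top: "\<top>\<^bsub>C\<^esub> = carrier L \<times> carrier M"
  by (rule partial_order.top_eqI[OF partial_order_coprod]) (auto intro: C_ideal_all dest: C_idealD(1))

lemma C_ideal_bot:
  assumes "C_ideal L M D"
  shows "y \<in> carrier M \<Longrightarrow> (\<bottom>\<^bsub>L\<^esub>, y) \<in> D" "x \<in> carrier L \<Longrightarrow> (x, \<bottom>\<^bsub>M\<^esub>) \<in> D"
  using C_idealD(3)[OF assms, of "{}" y] C_idealD(4)[OF assms, of x "{}"]
  by (auto simp: L.sup_empty_eq M.sup_empty_eq)

lemma L_le_bot: "\<lbrakk>x \<in> carrier L; x \<sqsubseteq>\<^bsub>L\<^esub> \<bottom>\<^bsub>L\<^esub>\<rbrakk> \<Longrightarrow> x = \<bottom>\<^bsub>L\<^esub>"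
  by (intro L.le_antisym) auto
lemma M_le_bot: "\<lbrakk>x \<in> carrier M; x \<sqsubseteq>\<^bsub>M\<^esub> \<bottom>\<^bsub>M\<^esub>\<rbrakk> \<Longrightarrow> x = \<bottom>\<^bsub>M\<^esub>"
  by (intro M.le_antisym) auto

lemma M_sup_bot:
  assumes "S \<subseteq> carrier M" "\<And>s. s \<in> S \<Longrightarrow> s = \<bottom>\<^bsub>M\<^esub>" shows "\<Squnion>\<^bsub>M\<^esub> S = \<bottom>\<^bsub>M\<^esub>"
proof (rule M_le_bot)
  show "\<Squnion>\<^bsub>M\<^esub> S \<sqsubseteq>\<^bsub>M\<^esub> \<bottom>\<^bsub>M\<^esub>"
    using assms by (intro M.sup_least) (metis M.bottom_closed M.le_refl)+
qed (use assms in simp)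

lemma L_sup_bot:
  assumes "S \<subseteq> carrier L" "\<And>s. s \<in> S \<Longrightarrow> s = \<bottom>\<^bsub>L\<^esub>" shows "\<Squnion>\<^bsub>L\<^esub> S = \<bottom>\<^bsub>L\<^esub>"
proof (rule L_le_bot)
  show "\<Squnion>\<^bsub>L\<^esub> S \<sqsubseteq>\<^bsub>L\<^esub> \<bottom>\<^bsub>L\<^esub>"
    using assms by (intro L.sup_least) (metis L.bottom_closed L.le_refl)+
qed (use assms in simp)

lemma C_ideal_left: 
  assumes "a \<in> carrier L" shows "C_ideal L M (coproj_left L M a)"
proof (rule C_idealI)
  fix S b assume "S \<subseteq> carrier L" "b \<in> carrier M" "\<And>s. s \<in> S \<Longrightarrow> (s, b) \<in> coproj_left L M a"
  then show "(\<Squnion>\<^bsub>L\<^esub> S, b) \<in> coproj_left L M a"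
    using assms by (cases "b = \<bottom>\<^bsub>M\<^esub>") (auto simp: coproj_left_def intro!: L.sup_least)
next
  fix x S assume h: "x \<in> carrier L" "S \<subseteq> carrier M" "\<And>s. s \<in> S \<Longrightarrow> (x, s) \<in> coproj_left L M a"
  show "(x, \<Squnion>\<^bsub>M\<^esub> S) \<in> coproj_left L M a"
  proof (cases "x \<sqsubseteq>\<^bsub>L\<^esub> a")
    case False
    then have "\<Squnion>\<^bsub>M\<^esub> S = \<bottom>\<^bsub>M\<^esub>" using h by (intro M_sup_bot) (auto simp: coproj_left_def)
    then show ?thesis using h by (auto simp: coproj_left_def)
  qed (use h in \<open>auto simp: coproj_left_def\<close>)
next
  fix x y x' y' assume "(x, y) \<in> coproj_left L M a" "x' \<in> carrier L" "y' \<in> carrier M"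
    "x' \<sqsubseteq>\<^bsub>L\<^esub> x" "y' \<sqsubseteq>\<^bsub>M\<^esub> y"
  then show "(x', y') \<in> coproj_left L M a"
    using assms by (auto simp: coproj_left_def intro: L.le_trans M_le_bot)
qed (auto simp: coproj_left_def)

lemma C_ideal_right: 
  assumes "b \<in> carrier M" shows "C_ideal L M (coproj_right L M b)"
proof (rule C_idealI)
  fix x S assume "x \<in> carrier L" "S \<subseteq> carrier M" "\<And>s. s \<in> S \<Longrightarrow> (x, s) \<in> coproj_right L M b"
  then show "(x, \<Squnion>\<^bsub>M\<^esub> S) \<in> coproj_right L M b"
    using assms by (cases "x = \<bottom>\<^bsub>L\<^esub>") (auto simp: coproj_right_def intro!: M.sup_least)
next
  fix S y assume h: "S \<subseteq> carrier L" "y \<in> carrier M" "\<And>s. s \<in> S \<Longrightarrow> (s, y) \<in> coproj_right L M b"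
  show "(\<Squnion>\<^bsub>L\<^esub> S, y) \<in> coproj_right L M b"
  proof (cases "y \<sqsubseteq>\<^bsub>M\<^esub> b")
    case False
    then have "\<Squnion>\<^bsub>L\<^esub> S = \<bottom>\<^bsub>L\<^esub>" using h by (intro L_sup_bot) (auto simp: coproj_right_def)
    then show ?thesis using h by (auto simp: coproj_right_def)
  qed (use h in \<open>auto simp: coproj_right_def\<close>)
next
  fix x y x' y' assume "(x, y) \<in> coproj_right L M b" "x' \<in> carrier L" "y' \<in> carrier M"
    "x' \<sqsubseteq>\<^bsub>L\<^esub> x" "y' \<sqsubseteq>\<^bsub>M\<^esub> y"
  then show "(x', y') \<in> coproj_right L M b"
    using assms by (auto simp: coproj_right_def intro: M.le_trans L_le_bot)
qed (auto simp: coproj_right_def)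

lemma coproj_left_hom: "coproj_left L M \<in> frame_hom L C"
  unfolding frame_hom_def
proof (intro CollectI conjI ballI allI impI)
  show "coproj_left L M \<in> carrier L \<rightarrow> carrier C" using C_ideal_left by auto
  show "coproj_left L M \<top>\<^bsub>L\<^esub> = \<top>\<^bsub>C\<^esub>" unfolding coprod_top by (auto simp: coproj_left_def)
  fix a b assume ab: "a \<in> carrier L" "b \<in> carrier L"
  show "coproj_left L M (a \<sqinter>\<^bsub>L\<^esub> b) = coproj_left L M a \<sqinter>\<^bsub>C\<^esub> coproj_left L M b"
    unfolding coprod_meet[OF C_ideal_left[OF ab(1)] C_ideal_left[OF ab(2)]]
    using ab by (auto simp: coproj_left_def intro: L.meet_le L.le_trans[OF _ L.meet_left] L.le_trans[OF _ L.meet_right])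
next
  fix S assume S: "S \<subseteq> carrier L"
  have sub: "coproj_left L M ` S \<subseteq> {D. C_ideal L M D}" using S C_ideal_left by auto
  have H: "C_ideal L M (cgen (\<Union>(coproj_left L M ` S)))" by (rule C_ideal_cgen[OF Union_carrier[OF sub]])
  show "coproj_left L M (\<Squnion>\<^bsub>L\<^esub> S) = \<Squnion>\<^bsub>C\<^esub> (coproj_left L M ` S)"
    unfolding coprod_sup[OF sub]
  proof
    show "cgen (\<Union> (coproj_left L M ` S)) \<subseteq> coproj_left L M (\<Squnion>\<^bsub>L\<^esub> S)"
      using S by (intro cgen_least C_ideal_left)
        (auto simp: coproj_left_def intro: L.le_trans[OF _ L.sup_upper])
    show "coproj_left L M (\<Squnion>\<^bsub>L\<^esub> S) \<subseteq> cgen (\<Union> (coproj_left L M ` S))"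
    proof clarify
      fix x y assume xy: "(x, y) \<in> coproj_left L M (\<Squnion>\<^bsub>L\<^esub> S)"
      then have c: "x \<in> carrier L" "y \<in> carrier M" by (auto simp: coproj_left_def)
      show "(x, y) \<in> cgen (\<Union> (coproj_left L M ` S))"
      proof (cases "y = \<bottom>\<^bsub>M\<^esub>")
        case False
        then have x: "x \<sqsubseteq>\<^bsub>L\<^esub> \<Squnion>\<^bsub>L\<^esub> S" using xy by (auto simp: coproj_left_def)
        have "(\<Squnion>\<^bsub>L\<^esub> S, y) \<in> cgen (\<Union> (coproj_left L M ` S))"
        proof (rule C_idealD(3)[OF H S c(2)])
          fix s assume "s \<in> S"
          then have "(s, y) \<in> coproj_left L M s" using S c \<open>s \<in> S\<close> by (auto simp: coproj_left_def)
          then show "(s, y) \<in> cgen (\<Union> (coproj_left L M ` S))" using cgen_upper[of "\<Union> (coproj_left L M ` S)"] \<open>s \<in> S\<close> by blast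
        qed
        then show ?thesis by (rule C_idealD(2)[OF H]) (use c x in auto)
      qed (use C_ideal_bot[OF H] c in auto)
    qed
  qed
qed

lemma coproj_right_hom: "coproj_right L M \<in> frame_hom M C"
  unfolding frame_hom_def
proof (intro CollectI conjI ballI allI impI)
  show "coproj_right L M \<in> carrier M \<rightarrow> carrier C" using C_ideal_right by auto
  show "coproj_right L M \<top>\<^bsub>M\<^esub> = \<top>\<^bsub>C\<^esub>" unfolding coprod_top by (auto simp: coproj_right_def)
  fix a b assume ab: "a \<in> carrier M" "b \<in> carrier M"
  show "coproj_right L M (a \<sqinter>\<^bsub>M\<^esub> b) = coproj_right L M a \<sqinter>\<^bsub>C\<^esub> coproj_right L M b"
    unfolding coprod_meet[OF C_ideal_right[OF ab(1)] C_ideal_right[OF ab(2)]]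
    using ab by (auto simp: coproj_right_def intro: M.meet_le M.le_trans[OF _ M.meet_left] M.le_trans[OF _ M.meet_right])
next
  fix S assume S: "S \<subseteq> carrier M"
  have sub: "coproj_right L M ` S \<subseteq> {D. C_ideal L M D}" using S C_ideal_right by auto
  have H: "C_ideal L M (cgen (\<Union>(coproj_right L M ` S)))" by (rule C_ideal_cgen[OF Union_carrier[OF sub]])
  show "coproj_right L M (\<Squnion>\<^bsub>M\<^esub> S) = \<Squnion>\<^bsub>C\<^esub> (coproj_right L M ` S)"
    unfolding coprod_sup[OF sub]
  proof
    show "cgen (\<Union> (coproj_right L M ` S)) \<subseteq> coproj_right L M (\<Squnion>\<^bsub>M\<^esub> S)"
      using S by (intro cgen_least C_ideal_right)
        (auto simp: coproj_right_def intro: M.le_trans[OF _ M.sup_upper])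
    show "coproj_right L M (\<Squnion>\<^bsub>M\<^esub> S) \<subseteq> cgen (\<Union> (coproj_right L M ` S))"
    proof clarify
      fix x y assume xy: "(x, y) \<in> coproj_right L M (\<Squnion>\<^bsub>M\<^esub> S)"
      then have c: "x \<in> carrier L" "y \<in> carrier M" by (auto simp: coproj_right_def)
      show "(x, y) \<in> cgen (\<Union> (coproj_right L M ` S))"
      proof (cases "x = \<bottom>\<^bsub>L\<^esub>")
        case False
        then have y: "y \<sqsubseteq>\<^bsub>M\<^esub> \<Squnion>\<^bsub>M\<^esub> S" using xy by (auto simp: coproj_right_def)
        have "(x, \<Squnion>\<^bsub>M\<^esub> S) \<in> cgen (\<Union> (coproj_right L M ` S))"
        proof (rule C_idealD(4)[OF H c(1) S])
          fix s assume "s \<in> S"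
          then have "(x, s) \<in> coproj_right L M s" using S c \<open>s \<in> S\<close> by (auto simp: coproj_right_def)
          then show "(x, s) \<in> cgen (\<Union> (coproj_right L M ` S))" using cgen_upper[of "\<Union> (coproj_right L M ` S)"] \<open>s \<in> S\<close> by blast
        qed
        then show ?thesis by (rule C_idealD(2)[OF H]) (use c y in auto)
      qed (use C_ideal_bot[OF H] c in auto)
    qed
  qed
qed

lemma coprod_generated:
  assumes "C_ideal L M D"
  shows "D = \<Squnion>\<^bsub>C\<^esub> ((\<lambda>(a, b). coproj_left L M a \<sqinter>\<^bsub>C\<^esub> coproj_right L M b) ` D)"
proof -
  let ?F = "(\<lambda>(a, b). coproj_left L M a \<inter> coproj_right L M b) ` D"
  have c: "a \<in> carrier L" "b \<in> carrier M" if "(a, b) \<in> D" for a b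
    using that C_idealD(1)[OF assms] by auto
  have eq: "(\<lambda>(a, b). coproj_left L M a \<sqinter>\<^bsub>C\<^esub> coproj_right L M b) ` D = ?F"
  proof (rule image_cong[OF refl])
    fix p assume "p \<in> D"
    then obtain a b where p: "p = (a, b)" "a \<in> carrier L" "b \<in> carrier M" using c by (cases p) auto
    then show "(case p of (a, b) \<Rightarrow> coproj_left L M a \<sqinter>\<^bsub>C\<^esub> coproj_right L M b) =
        (case p of (a, b) \<Rightarrow> coproj_left L M a \<inter> coproj_right L M b)"
      by (simp add: coprod_meet C_ideal_left C_ideal_right)
  qed
  have sub: "?F \<subseteq> {D. C_ideal L M D}"
    using c by (auto intro!: C_ideal_Int C_ideal_left C_ideal_right)
  have "\<Union>?F = D"
  proof
    show "\<Union>?F \<subseteq> D"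
    proof
      fix p assume "p \<in> \<Union>?F"
      then obtain a b x y where p: "p = (x, y)" and ab: "(a, b) \<in> D"
        and xy: "(x, y) \<in> coproj_left L M a" "(x, y) \<in> coproj_right L M b" by (cases p) auto
      have cx: "x \<in> carrier L" "y \<in> carrier M" using xy(1) by (auto simp: coproj_left_def)
      consider "x = \<bottom>\<^bsub>L\<^esub>" | "y = \<bottom>\<^bsub>M\<^esub>" | "x \<sqsubseteq>\<^bsub>L\<^esub> a" "y \<sqsubseteq>\<^bsub>M\<^esub> b"
        using xy by (auto simp: coproj_left_def coproj_right_def)
      then have "(x, y) \<in> D"
      proof cases
        case 1 then show ?thesis using C_ideal_bot(1)[OF assms cx(2)] by simp
      next
        case 2 then show ?thesis using C_ideal_bot(2)[OF assms cx(1)] by simp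
      next
        case 3 then show ?thesis by (rule C_idealD(2)[OF assms ab cx])
      qed
      then show "p \<in> D" using p by simp
    qed
    show "D \<subseteq> \<Union>?F"
    proof
      fix p assume "p \<in> D"
      then obtain a b where p: "p = (a, b)" "(a, b) \<in> D" by (cases p) auto
      then have "p \<in> coproj_left L M a \<inter> coproj_right L M b"
        using c[OF p(2)] by (auto simp: coproj_left_def coproj_right_def)
      then show "p \<in> \<Union>?F" using p(2) by blast
    qed
  qed
  moreover have "cgen D = D" using cgen_upper cgen_least[OF assms] by blast
  ultimately show ?thesis unfolding eq coprod_sup[OF sub] by simp
qed

definition copair :: "'c gorder \<Rightarrow> ('a \<Rightarrow> 'c) \<Rightarrow> ('b \<Rightarrow> 'c) \<Rightarrow> ('a \<times> 'b) set \<Rightarrow> 'c" where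
  "copair N f g D = \<Squnion>\<^bsub>N\<^esub> ((\<lambda>(a, b). f a \<sqinter>\<^bsub>N\<^esub> g b) ` D)"

lemma copair:
  assumes "frame N" "f \<in> frame_hom L N" "g \<in> frame_hom M N"
  shows "copair N f g \<in> frame_hom C N"
    "a \<in> carrier L \<Longrightarrow> copair N f g (coproj_left L M a) = f a"
    "b \<in> carrier M \<Longrightarrow> copair N f g (coproj_right L M b) = g b"
proof -
  interpret N: frame N by fact
  note f = frame_homD[OF assms(2)] and g = frame_homD[OF assms(3)]
  have fc [simp]: "f a \<in> carrier N" if "a \<in> carrier L" for a using f(1) that by auto
  have gc [simp]: "g a \<in> carrier N" if "a \<in> carrier M" for a using g(1) that by auto
  let ?p = "\<lambda>(a, b). f a \<sqinter>\<^bsub>N\<^esub> g b"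
  have pc: "?p ` D \<subseteq> carrier N" if "D \<subseteq> carrier L \<times> carrier M" for D
    using that by (auto intro!: N.meet_closed)
  have fbot: "f \<bottom>\<^bsub>L\<^esub> = \<bottom>\<^bsub>N\<^esub>" and gbot: "g \<bottom>\<^bsub>M\<^esub> = \<bottom>\<^bsub>N\<^esub>"
    using f(4)[of "{}"] g(4)[of "{}"] by (simp_all add: L.sup_empty_eq M.sup_empty_eq N.sup_empty_eq)
  have botm: "\<bottom>\<^bsub>N\<^esub> \<sqinter>\<^bsub>N\<^esub> x = \<bottom>\<^bsub>N\<^esub>" "x \<sqinter>\<^bsub>N\<^esub> \<bottom>\<^bsub>N\<^esub> = \<bottom>\<^bsub>N\<^esub>" if "x \<in> carrier N" for x
    using N.le_iff_meet[of "\<bottom>\<^bsub>N\<^esub>" x] that by (auto simp: meet_comm)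
  have topm: "\<top>\<^bsub>N\<^esub> \<sqinter>\<^bsub>N\<^esub> x = x" "x \<sqinter>\<^bsub>N\<^esub> \<top>\<^bsub>N\<^esub> = x" if "x \<in> carrier N" for x
    using N.le_iff_meet[of x "\<top>\<^bsub>N\<^esub>"] that by (auto simp: meet_comm)
  have below: "C_ideal L M {(x, y) \<in> carrier L \<times> carrier M. f x \<sqinter>\<^bsub>N\<^esub> g y \<sqsubseteq>\<^bsub>N\<^esub> n}" (is "C_ideal L M ?J")
    if n: "n \<in> carrier N" for n
  proof (rule C_idealI)
    fix a b a' b' assume h: "(a, b) \<in> ?J" "a' \<in> carrier L" "b' \<in> carrier M" "a' \<sqsubseteq>\<^bsub>L\<^esub> a" "b' \<sqsubseteq>\<^bsub>M\<^esub> b"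
    then have "f a' \<sqsubseteq>\<^bsub>N\<^esub> f a" "g b' \<sqsubseteq>\<^bsub>N\<^esub> g b"
      using frame_hom_mono[OF L.frame_axioms assms(1,2)] frame_hom_mono[OF M.frame_axioms assms(1,3)] by auto
    then have "f a' \<sqinter>\<^bsub>N\<^esub> g b' \<sqsubseteq>\<^bsub>N\<^esub> f a \<sqinter>\<^bsub>N\<^esub> g b" using h by (intro N.meet_mono) auto
    moreover have "f a \<sqinter>\<^bsub>N\<^esub> g b \<sqsubseteq>\<^bsub>N\<^esub> n" using h by auto
    ultimately have "f a' \<sqinter>\<^bsub>N\<^esub> g b' \<sqsubseteq>\<^bsub>N\<^esub> n"
      by (rule N.le_trans) (use h n in auto)
    then show "(a', b') \<in> ?J" using h by auto
  next
    fix S b assume h: "S \<subseteq> carrier L" "b \<in> carrier M" "\<And>s. s \<in> S \<Longrightarrow> (s, b) \<in> ?J"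
    have "f (\<Squnion>\<^bsub>L\<^esub> S) \<sqinter>\<^bsub>N\<^esub> g b = \<Squnion>\<^bsub>N\<^esub> ((\<lambda>s. g b \<sqinter>\<^bsub>N\<^esub> s) ` (f ` S))"
      unfolding f(4)[OF h(1)] meet_comm[of N _ "g b"] using h by (intro N.meet_Sup_distrib) auto
    also have "\<dots> \<sqsubseteq>\<^bsub>N\<^esub> n"
      using h n by (intro N.sup_least) (auto simp: meet_comm[of N "g b"] intro!: N.meet_closed)
    finally show "(\<Squnion>\<^bsub>L\<^esub> S, b) \<in> ?J" using h by auto
  next
    fix a S assume h: "a \<in> carrier L" "S \<subseteq> carrier M" "\<And>s. s \<in> S \<Longrightarrow> (a, s) \<in> ?J"
    have "f a \<sqinter>\<^bsub>N\<^esub> g (\<Squnion>\<^bsub>M\<^esub> S) = \<Squnion>\<^bsub>N\<^esub> ((\<lambda>s. f a \<sqinter>\<^bsub>N\<^esub> s) ` (g ` S))"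
      unfolding g(4)[OF h(2)] using h by (intro N.meet_Sup_distrib) auto
    also have "\<dots> \<sqsubseteq>\<^bsub>N\<^esub> n"
      using h n by (intro N.sup_least) (auto intro!: N.meet_closed)
    finally show "(a, \<Squnion>\<^bsub>M\<^esub> S) \<in> ?J" using h by auto
  qed auto
  have closed: "copair N f g D \<in> carrier N" if "D \<subseteq> carrier L \<times> carrier M" for D
    unfolding copair_def using pc[OF that] by simp
  have up: "f a \<sqinter>\<^bsub>N\<^esub> g b \<sqsubseteq>\<^bsub>N\<^esub> copair N f g D" if "D \<subseteq> carrier L \<times> carrier M" "(a, b) \<in> D" for a b D
    unfolding copair_def using pc[OF that(1)] that(2) by (intro N.sup_upper) auto
  have least: "copair N f g D \<sqsubseteq>\<^bsub>N\<^esub> n"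
    if "D \<subseteq> carrier L \<times> carrier M" "n \<in> carrier N" "\<And>a b. (a, b) \<in> D \<Longrightarrow> f a \<sqinter>\<^bsub>N\<^esub> g b \<sqsubseteq>\<^bsub>N\<^esub> n" for D n
    unfolding copair_def using pc[OF that(1)] that(2,3) by (intro N.sup_least) auto
  have mono: "copair N f g D \<sqsubseteq>\<^bsub>N\<^esub> copair N f g E" if "D \<subseteq> E" "E \<subseteq> carrier L \<times> carrier M" for D E
    using that by (intro least closed up) auto
  have left: "copair N f g (coproj_left L M a) = f a" if a: "a \<in> carrier L" for a
  proof (rule N.le_antisym)
    have s: "coproj_left L M a \<subseteq> carrier L \<times> carrier M" using C_ideal_left[OF a] C_idealD(1) by blast
    show "copair N f g (coproj_left L M a) \<in> carrier N" by (rule closed[OF s])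
    show "copair N f g (coproj_left L M a) \<sqsubseteq>\<^bsub>N\<^esub> f a"
    proof (rule least[OF s])
      fix x y assume "(x, y) \<in> coproj_left L M a"
      then have xy: "x \<in> carrier L" "y \<in> carrier M" "x \<sqsubseteq>\<^bsub>L\<^esub> a \<or> y = \<bottom>\<^bsub>M\<^esub>" by (auto simp: coproj_left_def)
      show "f x \<sqinter>\<^bsub>N\<^esub> g y \<sqsubseteq>\<^bsub>N\<^esub> f a"
      proof (cases "y = \<bottom>\<^bsub>M\<^esub>")
        case True then show ?thesis using xy a by (simp add: gbot botm)
      next
        case False
        then have "f x \<sqsubseteq>\<^bsub>N\<^esub> f a" using xy a frame_hom_mono[OF L.frame_axioms assms(1,2)] by auto
        then show ?thesis using xy a by (intro N.le_trans[OF N.meet_left]) auto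
      qed
    qed (use a in simp)
    have "f a \<sqinter>\<^bsub>N\<^esub> g \<top>\<^bsub>M\<^esub> \<sqsubseteq>\<^bsub>N\<^esub> copair N f g (coproj_left L M a)"
      by (rule up[OF s]) (use a in \<open>auto simp: coproj_left_def\<close>)
    then show "f a \<sqsubseteq>\<^bsub>N\<^esub> copair N f g (coproj_left L M a)" using a by (simp add: g(2) topm)
  qed (use a in simp)
  have right: "copair N f g (coproj_right L M b) = g b" if b: "b \<in> carrier M" for b
  proof (rule N.le_antisym)
    have s: "coproj_right L M b \<subseteq> carrier L \<times> carrier M" using C_ideal_right[OF b] C_idealD(1) by blast
    show "copair N f g (coproj_right L M b) \<in> carrier N" by (rule closed[OF s])
    show "copair N f g (coproj_right L M b) \<sqsubseteq>\<^bsub>N\<^esub> g b"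
    proof (rule least[OF s])
      fix x y assume "(x, y) \<in> coproj_right L M b"
      then have xy: "x \<in> carrier L" "y \<in> carrier M" "y \<sqsubseteq>\<^bsub>M\<^esub> b \<or> x = \<bottom>\<^bsub>L\<^esub>" by (auto simp: coproj_right_def)
      show "f x \<sqinter>\<^bsub>N\<^esub> g y \<sqsubseteq>\<^bsub>N\<^esub> g b"
      proof (cases "x = \<bottom>\<^bsub>L\<^esub>")
        case True then show ?thesis using xy b by (simp add: fbot botm)
      next
        case False
        then have "g y \<sqsubseteq>\<^bsub>N\<^esub> g b" using xy b frame_hom_mono[OF M.frame_axioms assms(1,3)] by auto
        then show ?thesis using xy b by (intro N.le_trans[OF N.meet_right]) auto
      qed
    qed (use b in simp)
    have "f \<top>\<^bsub>L\<^esub> \<sqinter>\<^bsub>N\<^esub> g b \<sqsubseteq>\<^bsub>N\<^esub> copair N f g (coproj_right L M b)"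
      by (rule up[OF s]) (use b in \<open>auto simp: coproj_right_def\<close>)
    then show "g b \<sqsubseteq>\<^bsub>N\<^esub> copair N f g (coproj_right L M b)" using b by (simp add: f(2) topm)
  qed (use b in simp)
  show "a \<in> carrier L \<Longrightarrow> copair N f g (coproj_left L M a) = f a" by (rule left)
  show "b \<in> carrier M \<Longrightarrow> copair N f g (coproj_right L M b) = g b" by (rule right)
  show "copair N f g \<in> frame_hom C N"
    unfolding frame_hom_def
  proof (intro CollectI conjI ballI allI impI)
    show "copair N f g \<in> carrier C \<rightarrow> carrier N" using closed C_idealD(1) by (simp add: Pi_iff) blast
    have "\<top>\<^bsub>C\<^esub> = coproj_left L M \<top>\<^bsub>L\<^esub>" using frame_homD(2)[OF coproj_left_hom] by simp
    then show "copair N f g \<top>\<^bsub>C\<^esub> = \<top>\<^bsub>N\<^esub>" using left[of "\<top>\<^bsub>L\<^esub>"] f(2) by simp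
  next
    fix D E assume "D \<in> carrier C" "E \<in> carrier C"
    then have D: "C_ideal L M D" and E: "C_ideal L M E" by auto
    note Ds = C_idealD(1)[OF D] and Es = C_idealD(1)[OF E]
    have "copair N f g D \<sqinter>\<^bsub>N\<^esub> copair N f g E = \<Squnion>\<^bsub>N\<^esub> ((\<lambda>(u, v). u \<sqinter>\<^bsub>N\<^esub> v) ` (?p ` D \<times> ?p ` E))"
      unfolding copair_def using pc[OF Ds] pc[OF Es] by (rule N.meet_Sup_Sup)
    also have "\<dots> \<sqsubseteq>\<^bsub>N\<^esub> copair N f g (D \<inter> E)"
    proof (rule N.sup_least)
      show "(\<lambda>(u, v). u \<sqinter>\<^bsub>N\<^esub> v) ` (?p ` D \<times> ?p ` E) \<subseteq> carrier N"
        by (rule N.meet_image_closed[OF pc[OF Ds] pc[OF Es]])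
      show "copair N f g (D \<inter> E) \<in> carrier N" using Ds by (intro closed) auto
      fix x assume "x \<in> (\<lambda>(u, v). u \<sqinter>\<^bsub>N\<^esub> v) ` (?p ` D \<times> ?p ` E)"
      then obtain a b a' b' where ab: "(a, b) \<in> D" "(a', b') \<in> E"
        and x: "x = (f a \<sqinter>\<^bsub>N\<^esub> g b) \<sqinter>\<^bsub>N\<^esub> (f a' \<sqinter>\<^bsub>N\<^esub> g b')" by auto
      have c: "a \<in> carrier L" "b \<in> carrier M" "a' \<in> carrier L" "b' \<in> carrier M" using ab Ds Es by auto
      have "x = (f a \<sqinter>\<^bsub>N\<^esub> f a') \<sqinter>\<^bsub>N\<^esub> (g b \<sqinter>\<^bsub>N\<^esub> g b')"
        unfolding x using c by (intro N.meet_interchange) auto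
      also have "\<dots> = f (a \<sqinter>\<^bsub>L\<^esub> a') \<sqinter>\<^bsub>N\<^esub> g (b \<sqinter>\<^bsub>M\<^esub> b')" using c by (simp add: f(3) g(3))
      also have "\<dots> \<sqsubseteq>\<^bsub>N\<^esub> copair N f g (D \<inter> E)"
      proof (rule up)
        have "(a \<sqinter>\<^bsub>L\<^esub> a', b \<sqinter>\<^bsub>M\<^esub> b') \<in> D"
          using c by (intro C_idealD(2)[OF D ab(1)]) (auto intro: L.meet_left M.meet_left)
        moreover have "(a \<sqinter>\<^bsub>L\<^esub> a', b \<sqinter>\<^bsub>M\<^esub> b') \<in> E"
          using c by (intro C_idealD(2)[OF E ab(2)]) (auto intro: L.meet_right M.meet_right)
        ultimately show "(a \<sqinter>\<^bsub>L\<^esub> a', b \<sqinter>\<^bsub>M\<^esub> b') \<in> D \<inter> E" by simp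
      qed (use Ds in auto)
      finally show "x \<sqsubseteq>\<^bsub>N\<^esub> copair N f g (D \<inter> E)" .
    qed
    finally have 1: "copair N f g D \<sqinter>\<^bsub>N\<^esub> copair N f g E \<sqsubseteq>\<^bsub>N\<^esub> copair N f g (D \<inter> E)" .
    have 2: "copair N f g (D \<inter> E) \<sqsubseteq>\<^bsub>N\<^esub> copair N f g D \<sqinter>\<^bsub>N\<^esub> copair N f g E"
      using Ds Es by (intro N.meet_le mono closed) auto
    show "copair N f g (D \<sqinter>\<^bsub>C\<^esub> E) = copair N f g D \<sqinter>\<^bsub>N\<^esub> copair N f g E"
      unfolding coprod_meet[OF D E] using 1 2 Ds Es by (intro N.le_antisym closed N.meet_closed) auto
  next
    fix S assume "S \<subseteq> carrier C"
    then have S: "S \<subseteq> {D. C_ideal L M D}" by simp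
    have Ss: "D \<subseteq> carrier L \<times> carrier M" if "D \<in> S" for D using S that C_idealD(1) by blast
    have H: "C_ideal L M (cgen (\<Union>S))" by (rule C_ideal_cgen[OF Union_carrier[OF S]])
    have cS: "copair N f g ` S \<subseteq> carrier N" using Ss closed by auto
    let ?n = "\<Squnion>\<^bsub>N\<^esub> (copair N f g ` S)"
    have n: "?n \<in> carrier N" using cS by simp
    have "cgen (\<Union>S) \<subseteq> {(x, y) \<in> carrier L \<times> carrier M. f x \<sqinter>\<^bsub>N\<^esub> g y \<sqsubseteq>\<^bsub>N\<^esub> ?n}"
    proof (rule cgen_least[OF below[OF n]], rule subsetI)
      fix p assume "p \<in> \<Union>S"
      then obtain x y D where p: "p = (x, y)" and xy: "(x, y) \<in> D" "D \<in> S" by (cases p) auto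
      have c: "x \<in> carrier L" "y \<in> carrier M" using xy Ss by auto
      have "f x \<sqinter>\<^bsub>N\<^esub> g y \<sqsubseteq>\<^bsub>N\<^esub> ?n"
        by (rule N.le_trans[OF up[OF Ss[OF xy(2)] xy(1)] N.sup_upper[OF cS]])
          (use c xy Ss n closed in auto)
      then show "p \<in> {(x, y) \<in> carrier L \<times> carrier M. f x \<sqinter>\<^bsub>N\<^esub> g y \<sqsubseteq>\<^bsub>N\<^esub> ?n}" using c p by simp
    qed
    then have 1: "copair N f g (cgen (\<Union>S)) \<sqsubseteq>\<^bsub>N\<^esub> ?n"
      using n C_idealD(1)[OF H] by (intro least) auto
    have 2: "?n \<sqsubseteq>\<^bsub>N\<^esub> copair N f g (cgen (\<Union>S))"
      using C_idealD(1)[OF H] cgen_upper[of "\<Union>S"] cS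
      by (intro N.sup_least closed) (auto intro!: mono)
    show "copair N f g (\<Squnion>\<^bsub>C\<^esub> S) = ?n"
      unfolding coprod_sup[OF S] using 1 2 n closed[OF C_idealD(1)[OF H]] by (intro N.le_antisym)
  qed
qed

end


subsection \<open>Quotients\<close>

lemma congruenceD:
  assumes "frame_congruence L \<theta>"
  shows "equiv (carrier L) \<theta>"
    "\<lbrakk>(a, a') \<in> \<theta>; (b, b') \<in> \<theta>\<rbrakk> \<Longrightarrow> (a \<sqinter>\<^bsub>L\<^esub> b, a' \<sqinter>\<^bsub>L\<^esub> b') \<in> \<theta>"
    "R \<subseteq> \<theta> \<Longrightarrow> (\<Squnion>\<^bsub>L\<^esub> (fst ` R), \<Squnion>\<^bsub>L\<^esub> (snd ` R)) \<in> \<theta>"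
  using assms unfolding frame_congruence_def by blast+

locale frame_with_congruence = frame L for L :: "'a gorder" (structure) +
  fixes \<theta> assumes cong: "frame_congruence L \<theta>"
begin

abbreviation Q where "Q \<equiv> quotient_frame L \<theta>"
abbreviation q where "q \<equiv> \<lambda>a. \<theta> `` {a}"

lemma eqv: "equiv (carrier L) \<theta>" by (rule congruenceD(1)[OF cong])

lemma Q_simps [simp]: "carrier Q = carrier L // \<theta>" "eq Q = (=)"
  by (auto simp: quotient_frame_def)

lemma Q_le:
  assumes "a \<in> carrier L" "b \<in> carrier L"
  shows "q a \<sqsubseteq>\<^bsub>Q\<^esub> q b \<longleftrightarrow> (a \<sqinter> b, a) \<in> \<theta>"
proof
  assume "q a \<sqsubseteq>\<^bsub>Q\<^esub> q b"
  then obtain a' b' where ab: "(a, a') \<in> \<theta>" "(b, b') \<in> \<theta>" "a' \<sqsubseteq> b'" by (auto simp: quotient_frame_def)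
  then have c: "a' \<in> carrier L" "b' \<in> carrier L" using eqv by (auto dest: equiv_type)
  have "(a \<sqinter> b, a' \<sqinter> b') \<in> \<theta>" using ab by (intro congruenceD(2)[OF cong])
  moreover have "a' \<sqinter> b' = a'" using le_iff_meet c ab(3) by blast
  ultimately show "(a \<sqinter> b, a) \<in> \<theta>"
    using eqv ab(1) by (metis equivE symD transD)
next
  assume "(a \<sqinter> b, a) \<in> \<theta>"
  then have "(a, a \<sqinter> b) \<in> \<theta>" using eqv by (metis equivE symD)
  moreover have "(b, b) \<in> \<theta>" using eqv assms by (metis equivE refl_onD)
  moreover have "a \<sqinter> b \<sqsubseteq> b" using assms by (intro meet_right)
  ultimately show "q a \<sqsubseteq>\<^bsub>Q\<^esub> q b" by (auto simp: quotient_frame_def)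
qed

lemma Q_eq: "\<lbrakk>a \<in> carrier L; b \<in> carrier L\<rbrakk> \<Longrightarrow> q a = q b \<longleftrightarrow> (a, b) \<in> \<theta>"
  by (rule eq_equiv_class_iff[OF eqv])

lemma q_closed [simp]: "a \<in> carrier L \<Longrightarrow> q a \<in> carrier L // \<theta>" by (rule quotientI)

lemma Q_cases:
  assumes "A \<in> carrier L // \<theta>" obtains a where "a \<in> carrier L" "A = q a"
  using assms by (auto elim: quotientE)

lemma Q_le_mono: "\<lbrakk>a \<in> carrier L; b \<in> carrier L; a \<sqsubseteq> b\<rbrakk> \<Longrightarrow> q a \<sqsubseteq>\<^bsub>Q\<^esub> q b"
  using Q_le[of a b] le_iff_meet[of a b] eqv by (metis equivE refl_onD)

lemma meet_refl_cong: "a \<in> carrier L \<Longrightarrow> (a, a) \<in> \<theta>" using eqv by (metis equivE refl_onD)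
lemma cong_sym: "(a, b) \<in> \<theta> \<Longrightarrow> (b, a) \<in> \<theta>" using eqv by (metis equivE symD)
lemma cong_trans: "(a, b) \<in> \<theta> \<Longrightarrow> (b, c) \<in> \<theta> \<Longrightarrow> (a, c) \<in> \<theta>" using eqv by (metis equivE transD)

lemma po: "partial_order Q"
proof (unfold_locales, goal_cases)
  case (4 A)
  then obtain a where "a \<in> carrier L" "A = q a" by (auto elim: Q_cases)
  then show ?case using Q_le_mono by simp
next
  case (5 A B)
  then obtain a b where ab: "a \<in> carrier L" "A = q a" "b \<in> carrier L" "B = q b" by (auto elim!: Q_cases)
  then have "(a \<sqinter> b, a) \<in> \<theta>" "(b \<sqinter> a, b) \<in> \<theta>" using 5 Q_le by auto
  then have "(a, b) \<in> \<theta>" using meet_comm[of L a b] cong_sym cong_trans by metis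
  then show ?case using ab Q_eq by simp
next
  case (6 A B D)
  then obtain a b d where ab: "a \<in> carrier L" "A = q a" "b \<in> carrier L" "B = q b" "d \<in> carrier L" "D = q d"
    by (auto elim!: Q_cases)
  then have 1: "(a \<sqinter> b, a) \<in> \<theta>" and 2: "(b \<sqinter> d, b) \<in> \<theta>" using 6 Q_le by auto
  have "(a \<sqinter> d, (a \<sqinter> b) \<sqinter> d) \<in> \<theta>"
    by (rule congruenceD(2)[OF cong cong_sym[OF 1] meet_refl_cong]) (use ab in auto)
  moreover have "(a \<sqinter> (b \<sqinter> d), a \<sqinter> b) \<in> \<theta>"
    by (rule congruenceD(2)[OF cong meet_refl_cong 2]) (use ab in auto)
  ultimately have "(a \<sqinter> d, a) \<in> \<theta>"
    using 1 cong_trans meet_assoc[OF ab(1,3,5)] by metis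
  then show ?case using ab Q_le by simp
qed auto

lemma Q_lub:
  assumes S: "S \<subseteq> carrier L"
  shows "\<And>a. a \<in> S \<Longrightarrow> q a \<sqsubseteq>\<^bsub>Q\<^esub> q (\<Squnion>S)"
    "\<lbrakk>y \<in> carrier L; \<And>a. a \<in> S \<Longrightarrow> q a \<sqsubseteq>\<^bsub>Q\<^esub> q y\<rbrakk> \<Longrightarrow> q (\<Squnion>S) \<sqsubseteq>\<^bsub>Q\<^esub> q y"
proof -
  show "q a \<sqsubseteq>\<^bsub>Q\<^esub> q (\<Squnion>S)" if "a \<in> S" for a using that S by (intro Q_le_mono sup_upper) auto
  assume y: "y \<in> carrier L" "\<And>a. a \<in> S \<Longrightarrow> q a \<sqsubseteq>\<^bsub>Q\<^esub> q y"
  let ?R = "(\<lambda>a. (y \<sqinter> a, a)) ` S"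
  have "?R \<subseteq> \<theta>"
  proof clarify
    fix a assume a: "a \<in> S"
    then have "(a \<sqinter> y, a) \<in> \<theta>" using y Q_le S by blast
    then show "(y \<sqinter> a, a) \<in> \<theta>" by (simp add: meet_comm[of L y a])
  qed
  from congruenceD(3)[OF cong this] have "(\<Squnion>((\<lambda>a. y \<sqinter> a) ` S), \<Squnion>S) \<in> \<theta>"
    by (simp add: image_image)
  then have "(y \<sqinter> \<Squnion>S, \<Squnion>S) \<in> \<theta>" using meet_Sup_distrib[OF y(1) S] by simp
  then have "(\<Squnion>S \<sqinter> y, \<Squnion>S) \<in> \<theta>" by (simp add: meet_comm[of L y])
  then show "q (\<Squnion>S) \<sqsubseteq>\<^bsub>Q\<^esub> q y" using Q_le y S by simp
qed

lemma Q_sup: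
  assumes S: "S \<subseteq> carrier L" shows "\<Squnion>\<^bsub>Q\<^esub> (q ` S) = q (\<Squnion>S)"
proof (rule partial_order.sup_eqI[OF po])
  show "q ` S \<subseteq> carrier Q" using S by auto
  show "q (\<Squnion>S) \<in> carrier Q" using S by simp
  show "A \<sqsubseteq>\<^bsub>Q\<^esub> q (\<Squnion>S)" if "A \<in> q ` S" for A using that Q_lub(1)[OF S] by auto
  fix B assume B: "B \<in> carrier Q" "\<And>A. A \<in> q ` S \<Longrightarrow> A \<sqsubseteq>\<^bsub>Q\<^esub> B"
  then obtain b where "b \<in> carrier L" "B = q b" by (auto elim: Q_cases)
  then show "q (\<Squnion>S) \<sqsubseteq>\<^bsub>Q\<^esub> B" using B Q_lub(2)[OF S] by auto
qed

lemma Q_meet: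
  assumes ab: "a \<in> carrier L" "b \<in> carrier L" shows "q a \<sqinter>\<^bsub>Q\<^esub> q b = q (a \<sqinter> b)"
proof (rule partial_order.meet_eqI[OF po])
  show "q (a \<sqinter> b) \<sqsubseteq>\<^bsub>Q\<^esub> q a" "q (a \<sqinter> b) \<sqsubseteq>\<^bsub>Q\<^esub> q b"
    using ab by (auto intro!: Q_le_mono meet_left meet_right)
  fix Y assume Y: "Y \<in> carrier Q" "Y \<sqsubseteq>\<^bsub>Q\<^esub> q a" "Y \<sqsubseteq>\<^bsub>Q\<^esub> q b"
  then obtain y where y: "y \<in> carrier L" "Y = q y" by (auto elim: Q_cases)
  then have 1: "(y \<sqinter> a, y) \<in> \<theta>" and 2: "(y \<sqinter> b, y) \<in> \<theta>" using Y Q_le ab by auto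
  have "((y \<sqinter> a) \<sqinter> b, y \<sqinter> b) \<in> \<theta>"
    by (rule congruenceD(2)[OF cong 1 meet_refl_cong]) (rule ab)
  then have "(y \<sqinter> (a \<sqinter> b), y) \<in> \<theta>" using 2 cong_trans meet_assoc[OF y(1) ab] by metis
  then show "Y \<sqsubseteq>\<^bsub>Q\<^esub> q (a \<sqinter> b)" using y Q_le ab by simp
qed (use ab in auto)

lemma Q_sub_reps:
  assumes "F \<subseteq> carrier L // \<theta>" obtains S where "S \<subseteq> carrier L" "F = q ` S"
proof
  show "{a \<in> carrier L. q a \<in> F} \<subseteq> carrier L" by auto
  show "F = q ` {a \<in> carrier L. q a \<in> F}" using assms by (auto elim!: Q_cases)
qed

lemma frame_Q: "frame Q"
proof (rule frame_cong_meet_Sup_le[OF po])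
  fix F assume "F \<subseteq> carrier Q"
  then obtain S where S: "S \<subseteq> carrier L" "F = q ` S" using Q_sub_reps[of F] by auto
  show "\<exists>x\<in>carrier Q. (\<forall>a\<in>F. a \<sqsubseteq>\<^bsub>Q\<^esub> x) \<and> (\<forall>y\<in>carrier Q. (\<forall>a\<in>F. a \<sqsubseteq>\<^bsub>Q\<^esub> y) \<longrightarrow> x \<sqsubseteq>\<^bsub>Q\<^esub> y)"
  proof (intro bexI[of _ "q (\<Squnion>S)"] conjI ballI impI)
    show "a \<sqsubseteq>\<^bsub>Q\<^esub> q (\<Squnion>S)" if "a \<in> F" for a using that S Q_lub(1)[OF S(1)] by auto
    fix B assume B: "B \<in> carrier Q" "\<forall>a\<in>F. a \<sqsubseteq>\<^bsub>Q\<^esub> B"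
    then obtain b where "b \<in> carrier L" "B = q b" by (auto elim: Q_cases)
    then show "q (\<Squnion>S) \<sqsubseteq>\<^bsub>Q\<^esub> B" using B S Q_lub(2)[OF S(1)] by auto
  qed (use S in simp)
next
  fix A F assume "A \<in> carrier Q" "F \<subseteq> carrier Q"
  then obtain a S where a: "a \<in> carrier L" "A = q a" and S: "S \<subseteq> carrier L" "F = q ` S"
    using Q_sub_reps Q_cases by (metis Q_simps(1))
  have "(\<lambda>s. A \<sqinter>\<^bsub>Q\<^esub> s) ` F = q ` ((\<lambda>s. a \<sqinter> s) ` S)"
    unfolding S a image_image using S(1) a(1) by (intro image_cong refl Q_meet) auto
  moreover have "(\<lambda>s. a \<sqinter> s) ` S \<subseteq> carrier L" using S(1) a(1) by auto
  ultimately have "\<Squnion>\<^bsub>Q\<^esub> ((\<lambda>s. A \<sqinter>\<^bsub>Q\<^esub> s) ` F) = q (\<Squnion>((\<lambda>s. a \<sqinter> s) ` S))"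
    using Q_sup by simp
  also have "\<dots> = q (a \<sqinter> \<Squnion>S)" using meet_Sup_distrib[OF a(1) S(1)] by simp
  also have "\<dots> = A \<sqinter>\<^bsub>Q\<^esub> \<Squnion>\<^bsub>Q\<^esub> F" using Q_meet[OF a(1), of "\<Squnion>S"] Q_sup[OF S(1)] S a by simp
  finally have e: "\<Squnion>\<^bsub>Q\<^esub> ((\<lambda>s. A \<sqinter>\<^bsub>Q\<^esub> s) ` F) = A \<sqinter>\<^bsub>Q\<^esub> \<Squnion>\<^bsub>Q\<^esub> F" .
  have "A \<sqinter>\<^bsub>Q\<^esub> \<Squnion>\<^bsub>Q\<^esub> F = q (a \<sqinter> \<Squnion>S)" using Q_meet[OF a(1), of "\<Squnion>S"] Q_sup[OF S(1)] S a by simp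
  then show "A \<sqinter>\<^bsub>Q\<^esub> \<Squnion>\<^bsub>Q\<^esub> F \<sqsubseteq>\<^bsub>Q\<^esub> \<Squnion>\<^bsub>Q\<^esub> ((\<lambda>s. A \<sqinter>\<^bsub>Q\<^esub> s) ` F)"
    unfolding e using a S(1) Q_le_mono[of "a \<sqinter> \<Squnion>S" "a \<sqinter> \<Squnion>S"] by simp
qed

lemma q_hom: "q \<in> frame_hom L Q"
proof -
  have "\<top>\<^bsub>Q\<^esub> = q \<top>"
  proof (rule partial_order.top_eqI[OF po])
    fix A assume "A \<in> carrier Q"
    then obtain a where "a \<in> carrier L" "A = q a" by (auto elim: Q_cases)
    then show "A \<sqsubseteq>\<^bsub>Q\<^esub> q \<top>" using Q_le_mono by simp
  qed simp
  then show ?thesis unfolding frame_hom_def by (auto simp: Q_meet Q_sup)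
qed

lemma factor:
  assumes h: "h \<in> frame_hom L N" and ker: "\<And>a b. (a, b) \<in> \<theta> \<Longrightarrow> h a = h b"
  obtains k where "k \<in> frame_hom Q N" "\<And>a. a \<in> carrier L \<Longrightarrow> k (q a) = h a"
proof
  define k where "k A = h (SOME a. a \<in> A)" for A
  show kq: "k (q a) = h a" if "a \<in> carrier L" for a
  proof -
    have "a \<in> q a" using meet_refl_cong[OF that] by simp
    then have "(SOME x. x \<in> q a) \<in> q a" by (rule someI)
    then show ?thesis unfolding k_def using ker by auto
  qed
  show "k \<in> frame_hom Q N"
    unfolding frame_hom_def
  proof (intro CollectI conjI ballI allI impI)
    show "k \<in> carrier Q \<rightarrow> carrier N"
    proof
      fix A assume "A \<in> carrier Q"
      then obtain a where a: "a \<in> carrier L" "A = q a" by (auto elim: Q_cases)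
      then show "k A \<in> carrier N" using kq frame_homD(1)[OF h] by auto
    qed
    show "k \<top>\<^bsub>Q\<^esub> = \<top>\<^bsub>N\<^esub>"
      using kq[of \<top>] frame_homD(2)[OF h] frame_homD(2)[OF q_hom] by simp
    fix A B assume "A \<in> carrier Q" "B \<in> carrier Q"
    then obtain a b where ab: "a \<in> carrier L" "A = q a" "b \<in> carrier L" "B = q b" by (auto elim!: Q_cases)
    show "k (A \<sqinter>\<^bsub>Q\<^esub> B) = k A \<sqinter>\<^bsub>N\<^esub> k B"
      unfolding ab(2,4) Q_meet[OF ab(1,3)] using ab(1,3) by (simp add: kq frame_homD(3)[OF h])
  next
    fix F assume "F \<subseteq> carrier Q"
    then obtain S where S: "S \<subseteq> carrier L" "F = q ` S" using Q_sub_reps[of F] by auto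
    have "k ` q ` S = h ` S" unfolding image_image using S(1) kq by (intro image_cong) auto
    then show "k (\<Squnion>\<^bsub>Q\<^esub> F) = \<Squnion>\<^bsub>N\<^esub> (k ` F)"
      unfolding S(2) Q_sup[OF S(1)] using S(1) by (simp add: kq frame_homD(4)[OF h])
  qed
qed

end

lemma frame_congruenceI:
  assumes "equiv (carrier L) \<theta>"
    "\<And>a a' b b'. \<lbrakk>(a, a') \<in> \<theta>; (b, b') \<in> \<theta>\<rbrakk> \<Longrightarrow> (a \<sqinter>\<^bsub>L\<^esub> b, a' \<sqinter>\<^bsub>L\<^esub> b') \<in> \<theta>"
    "\<And>R. R \<subseteq> \<theta> \<Longrightarrow> (\<Squnion>\<^bsub>L\<^esub> (fst ` R), \<Squnion>\<^bsub>L\<^esub> (snd ` R)) \<in> \<theta>"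
  shows "frame_congruence L \<theta>"
  unfolding frame_congruence_def
proof (intro conjI ballI allI impI)
  show "case p of (a, a') \<Rightarrow> \<forall>(b, b') \<in> \<theta>. (a \<sqinter>\<^bsub>L\<^esub> b, a' \<sqinter>\<^bsub>L\<^esub> b') \<in> \<theta>" if "p \<in> \<theta>" for p
    using that by (cases p) (auto intro: assms(2))
qed (use assms(1,3) in auto)

lemma congruence_imposed:
  assumes "frame L" "R \<subseteq> carrier L \<times> carrier L"
  shows "frame_congruence L (imposed_congruence L R)"
    "(a, b) \<in> R \<Longrightarrow> (a \<sqinter>\<^bsub>L\<^esub> b, a) \<in> imposed_congruence L R"
    "\<lbrakk>frame_congruence L \<theta>; \<And>a b. (a, b) \<in> R \<Longrightarrow> (a \<sqinter>\<^bsub>L\<^esub> b, a) \<in> \<theta>\<rbrakk> \<Longrightarrow> imposed_congruence L R \<subseteq> \<theta>"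
proof -
  interpret frame L by fact
  let ?T = "{\<theta>. frame_congruence L \<theta> \<and> (\<forall>(a, b) \<in> R. (a \<sqinter>\<^bsub>L\<^esub> b, a) \<in> \<theta>)}"
  have all: "carrier L \<times> carrier L \<in> ?T"
  proof -
    have "\<Squnion>\<^bsub>L\<^esub>(fst ` A) \<in> carrier L \<and> \<Squnion>\<^bsub>L\<^esub>(snd ` A) \<in> carrier L" if "A \<subseteq> carrier L \<times> carrier L" for A
      using that by (intro conjI sup_closed) auto
    moreover have "equiv (carrier L) (carrier L \<times> carrier L)"
      by (auto simp: equiv_def refl_on_def sym_def trans_def)
    ultimately have "frame_congruence L (carrier L \<times> carrier L)"
      unfolding frame_congruence_def by (auto intro!: meet_closed)
    then show ?thesis using assms(2) by (auto intro!: meet_closed)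
  qed
  have eqv: "equiv (carrier L) \<theta>" if "\<theta> \<in> ?T" for \<theta> using that congruenceD(1) by blast
  have "equiv (carrier L) (\<Inter>?T)"
  proof (rule equivI)
    show "\<Inter>?T \<subseteq> carrier L \<times> carrier L" by (rule Inter_lower[OF all])
    show "refl_on (carrier L) (\<Inter>?T)" 
    proof (rule refl_onI, rule InterI)
      fix x \<theta> assume "x \<in> carrier L" "\<theta> \<in> ?T"
      then show "(x, x) \<in> \<theta>" using eqv by (meson equivE refl_onD)
    qed
    show "sym (\<Inter>?T)" 
    proof (rule symI, rule InterI)
      fix x y \<theta> assume xy: "(x, y) \<in> \<Inter>?T" and t: "\<theta> \<in> ?T"
      show "(y, x) \<in> \<theta>" using InterD[OF xy t] eqv[OF t] by (meson equivE symD)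
    qed
    show "trans (\<Inter>?T)" 
    proof (rule transI, rule InterI)
      fix x y z \<theta> assume xy: "(x, y) \<in> \<Inter>?T" "(y, z) \<in> \<Inter>?T" and t: "\<theta> \<in> ?T"
      show "(x, z) \<in> \<theta>" using InterD[OF xy(1) t] InterD[OF xy(2) t] eqv[OF t] by (meson equivE transD)
    qed
  qed
  moreover have "(a \<sqinter>\<^bsub>L\<^esub> b, a' \<sqinter>\<^bsub>L\<^esub> b') \<in> \<Inter>?T" if "(a, a') \<in> \<Inter>?T" "(b, b') \<in> \<Inter>?T" for a b a' b'
  proof (rule InterI)
    fix \<theta> assume "\<theta> \<in> ?T"
    then have "frame_congruence L \<theta>" "(a, a') \<in> \<theta>" "(b, b') \<in> \<theta>"
      using InterD[OF that(1)] InterD[OF that(2)] by auto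
    then show "(a \<sqinter>\<^bsub>L\<^esub> b, a' \<sqinter>\<^bsub>L\<^esub> b') \<in> \<theta>" by (rule congruenceD(2))
  qed
  moreover have "(\<Squnion>\<^bsub>L\<^esub>(fst ` A), \<Squnion>\<^bsub>L\<^esub>(snd ` A)) \<in> \<Inter>?T" if "A \<subseteq> \<Inter>?T" for A
  proof (rule InterI)
    fix \<theta> assume "\<theta> \<in> ?T"
    then have "frame_congruence L \<theta>" "A \<subseteq> \<theta>" using subset_trans[OF that Inter_lower] by auto
    then show "(\<Squnion>\<^bsub>L\<^esub>(fst ` A), \<Squnion>\<^bsub>L\<^esub>(snd ` A)) \<in> \<theta>" by (rule congruenceD(3))
  qed
  ultimately show "frame_congruence L (imposed_congruence L R)"
    unfolding imposed_congruence_def by (rule frame_congruenceI)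
  show "(a \<sqinter>\<^bsub>L\<^esub> b, a) \<in> imposed_congruence L R" if "(a, b) \<in> R"
    unfolding imposed_congruence_def
  proof (rule InterI)
    fix \<theta> assume "\<theta> \<in> ?T"
    then show "(a \<sqinter>\<^bsub>L\<^esub> b, a) \<in> \<theta>" using that by auto
  qed
  show "imposed_congruence L R \<subseteq> \<theta>"
    if "frame_congruence L \<theta>" "\<And>a b. (a, b) \<in> R \<Longrightarrow> (a \<sqinter>\<^bsub>L\<^esub> b, a) \<in> \<theta>"
    unfolding imposed_congruence_def by (rule Inter_lower) (use that in auto)
qed

lemma kernel_congruence:
  assumes "frame L" "frame N" "h \<in> frame_hom L N"
  shows "frame_congruence L {(a, b). a \<in> carrier L \<and> b \<in> carrier L \<and> h a = h b}" (is "frame_congruence L ?K")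
proof -
  interpret frame L by fact
  have "equiv (carrier L) ?K" by (auto simp: equiv_def refl_on_def sym_def trans_def)
  moreover have "(a \<sqinter>\<^bsub>L\<^esub> b, a' \<sqinter>\<^bsub>L\<^esub> b') \<in> ?K" if "(a, a') \<in> ?K" "(b, b') \<in> ?K" for a b a' b'
    using that by (simp add: frame_homD(3)[OF assms(3)])
  moreover have "(\<Squnion>\<^bsub>L\<^esub>(fst ` A), \<Squnion>\<^bsub>L\<^esub>(snd ` A)) \<in> ?K" if "A \<subseteq> ?K" for A
  proof -
    have c: "fst ` A \<subseteq> carrier L" "snd ` A \<subseteq> carrier L" using that by auto
    have "h ` fst ` A = h ` snd ` A" unfolding image_image using that by (intro image_cong) auto
    then show ?thesis using c by (simp add: frame_homD(4)[OF assms(3)])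
  qed
  ultimately show ?thesis by (rule frame_congruenceI)
qed


subsection \<open>The finitary biframe of opens\<close>

lemma opens_two: "two_frames (opens_frame S) (opens_frame T)"
  by (intro two_frames.intro frame_opens)

lemma frame_opens_coprod: "frame (opens_coprod X)"
  unfolding opens_coprod_def by (rule two_frames.frame_coprod[OF opens_two])

lemma gen_pos_hom: "gen_pos X \<in> frame_hom (opens_frame (pos_top X)) (opens_coprod X)"
  unfolding gen_pos_def opens_coprod_def by (rule two_frames.coproj_left_hom[OF opens_two])

lemma gen_neg_hom: "gen_neg X \<in> frame_hom (opens_frame (neg_top X)) (opens_coprod X)"
  unfolding gen_neg_def opens_coprod_def by (rule two_frames.coproj_right_hom[OF opens_two])

lemma gen_closed:
  "openin (pos_top X) U \<Longrightarrow> gen_pos X U \<in> carrier (opens_coprod X)"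
  "openin (neg_top X) U' \<Longrightarrow> gen_neg X U' \<in> carrier (opens_coprod X)"
  using frame_homD(1)[OF gen_pos_hom, of X] frame_homD(1)[OF gen_neg_hom, of X] by auto

lemma fin_relationsE:
  assumes "(c, d) \<in> fin_relations X"
  obtains U U' V V' where "openin (pos_top X) U" "openin (neg_top X) U'"
    "openin (pos_top X) V" "openin (neg_top X) V'" "U \<inter> U' \<subseteq> V \<union> V'"
    "c = gen_pos X U \<sqinter>\<^bsub>opens_coprod X\<^esub> gen_neg X U'" "d = gen_pos X V \<squnion>\<^bsub>opens_coprod X\<^esub> gen_neg X V'"
  using assms unfolding fin_relations_def by auto

lemma fin_relations_carrier: "fin_relations X \<subseteq> carrier (opens_coprod X) \<times> carrier (opens_coprod X)"
proof -
  interpret frame "opens_coprod X" by (rule frame_opens_coprod)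
  show ?thesis by (auto elim!: fin_relationsE intro!: meet_closed join_closed gen_closed)
qed

lemmas imposed = congruence_imposed[OF frame_opens_coprod fin_relations_carrier, folded fin_congruence_def]

lemma fwc: "frame_with_congruence (opens_coprod X) (fin_congruence X)"
  by (intro frame_with_congruence.intro frame_opens_coprod frame_with_congruence_axioms.intro imposed(1))

lemma frame_Omega_fin: "frame (Omega_fin X)"
  unfolding Omega_fin_def by (rule frame_with_congruence.frame_Q[OF fwc])

lemma bOmega_fin_simps [simp]:
  "pos (bOmega_fin X) = opens_frame (pos_top X)" "neg (bOmega_fin X) = opens_frame (neg_top X)"
  "main (bOmega_fin X) = Omega_fin X"
  "pos_emb (bOmega_fin X) = (\<lambda>U. fin_congruence X `` {gen_pos X U})"
  "neg_emb (bOmega_fin X) = (\<lambda>U. fin_congruence X `` {gen_neg X U})"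
  by (auto simp: bOmega_fin_def)

lemma q_hom': "(\<lambda>a. fin_congruence X `` {a}) \<in> frame_hom (opens_coprod X) (Omega_fin X)"
  unfolding Omega_fin_def by (rule frame_with_congruence.q_hom[OF fwc])

lemma pos_emb_hom: "pos_emb (bOmega_fin X) \<in> frame_hom (opens_frame (pos_top X)) (Omega_fin X)"
  using frame_hom_comp[OF gen_pos_hom q_hom'] by simp

lemma neg_emb_hom: "neg_emb (bOmega_fin X) \<in> frame_hom (opens_frame (neg_top X)) (Omega_fin X)"
  using frame_hom_comp[OF gen_neg_hom q_hom'] by simp

lemma frame_hom_join:
  assumes "h \<in> frame_hom L M" "a \<in> carrier L" "b \<in> carrier L"
  shows "h (a \<squnion>\<^bsub>L\<^esub> b) = h a \<squnion>\<^bsub>M\<^esub> h b"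
  using frame_homD(4)[OF assms(1), of "{a, b}"] assms(2,3) by (simp add: join_def)

lemma Omega_fin_relation:
  assumes "openin (pos_top X) U" "openin (neg_top X) U'"
    "openin (pos_top X) V" "openin (neg_top X) V'" "U \<inter> U' \<subseteq> V \<union> V'"
  shows "pos_emb (bOmega_fin X) U \<sqinter>\<^bsub>Omega_fin X\<^esub> neg_emb (bOmega_fin X) U' \<sqsubseteq>\<^bsub>Omega_fin X\<^esub>
         pos_emb (bOmega_fin X) V \<squnion>\<^bsub>Omega_fin X\<^esub> neg_emb (bOmega_fin X) V'"
proof -
  interpret frame "opens_coprod X" by (rule frame_opens_coprod)
  let ?c = "gen_pos X U \<sqinter>\<^bsub>opens_coprod X\<^esub> gen_neg X U'"
  let ?d = "gen_pos X V \<squnion>\<^bsub>opens_coprod X\<^esub> gen_neg X V'"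
  have "(?c, ?d) \<in> fin_relations X" using assms unfolding fin_relations_def by blast
  then have "(?c \<sqinter>\<^bsub>opens_coprod X\<^esub> ?d, ?c) \<in> fin_congruence X" by (rule imposed(2))
  then have "fin_congruence X `` {?c} \<sqsubseteq>\<^bsub>Omega_fin X\<^esub> fin_congruence X `` {?d}"
    using frame_with_congruence.Q_le[OF fwc, of ?c X ?d] assms
    by (simp add: Omega_fin_def gen_closed)
  then show ?thesis
    using assms frame_homD(3)[OF q_hom', of "gen_pos X U" X "gen_neg X U'"]
      frame_hom_join[OF q_hom', of "gen_pos X V" X "gen_neg X V'"] by (simp add: gen_closed)
qed

lemma Omega_fin_universal:
  assumes N: "frame N" and f: "f \<in> frame_hom (opens_frame (pos_top X)) N"
    and g: "g \<in> frame_hom (opens_frame (neg_top X)) N"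
    and rel: "\<And>U U' V V'. \<lbrakk>openin (pos_top X) U; openin (neg_top X) U';
       openin (pos_top X) V; openin (neg_top X) V'; U \<inter> U' \<subseteq> V \<union> V'\<rbrakk> \<Longrightarrow>
       f U \<sqinter>\<^bsub>N\<^esub> g U' \<sqsubseteq>\<^bsub>N\<^esub> f V \<squnion>\<^bsub>N\<^esub> g V'"
  obtains k where "k \<in> frame_hom (Omega_fin X) N"
    "\<And>U. openin (pos_top X) U \<Longrightarrow> k (pos_emb (bOmega_fin X) U) = f U"
    "\<And>U. openin (neg_top X) U \<Longrightarrow> k (neg_emb (bOmega_fin X) U) = g U"
proof -
  interpret N: frame N by (rule N)
  interpret C: frame "opens_coprod X" by (rule frame_opens_coprod)
  define h where "h = two_frames.copair N f g"
  note co = two_frames.copair[OF opens_two N f g, folded opens_coprod_def h_def gen_pos_def gen_neg_def]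
  have h: "h \<in> frame_hom (opens_coprod X) N" by (rule co(1))
  have hp: "h (gen_pos X U) = f U" if "openin (pos_top X) U" for U using co(2) that by simp
  have hn: "h (gen_neg X U) = g U" if "openin (neg_top X) U" for U using co(3) that by simp
  let ?K = "{(a, b). a \<in> carrier (opens_coprod X) \<and> b \<in> carrier (opens_coprod X) \<and> h a = h b}"
  have "fin_congruence X \<subseteq> ?K"
  proof (rule imposed(3)[OF kernel_congruence[OF frame_opens_coprod N h]])
    fix c d assume cd: "(c, d) \<in> fin_relations X"
    then have cc: "c \<in> carrier (opens_coprod X)" "d \<in> carrier (opens_coprod X)"
      using fin_relations_carrier by auto
    from cd obtain U U' V V' where o: "openin (pos_top X) U" "openin (neg_top X) U'"
      "openin (pos_top X) V" "openin (neg_top X) V'" "U \<inter> U' \<subseteq> V \<union> V'"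
      and e: "c = gen_pos X U \<sqinter>\<^bsub>opens_coprod X\<^esub> gen_neg X U'" "d = gen_pos X V \<squnion>\<^bsub>opens_coprod X\<^esub> gen_neg X V'"
      by (rule fin_relationsE)
    have "h c = f U \<sqinter>\<^bsub>N\<^esub> g U'" "h d = f V \<squnion>\<^bsub>N\<^esub> g V'"
      unfolding e using o by (simp_all add: frame_homD(3)[OF h] frame_hom_join[OF h] gen_closed hp hn)
    then have "h c \<sqsubseteq>\<^bsub>N\<^esub> h d" using rel[OF o] by simp
    then have "h c \<sqinter>\<^bsub>N\<^esub> h d = h c"
      using N.le_iff_meet cc frame_homD(1)[OF h] by (meson Pi_mem)
    then show "(c \<sqinter>\<^bsub>opens_coprod X\<^esub> d, c) \<in> ?K"
      using cc by (simp add: frame_homD(3)[OF h])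
  qed
  then have ker: "h a = h b" if "(a, b) \<in> fin_congruence X" for a b using that by auto
  obtain k where k: "k \<in> frame_hom (Omega_fin X) N"
    "\<And>a. a \<in> carrier (opens_coprod X) \<Longrightarrow> k (fin_congruence X `` {a}) = h a"
    using frame_with_congruence.factor[OF fwc h ker] unfolding Omega_fin_def by blast
  show thesis
    by (rule that[OF k(1)]) (simp_all add: k(2) gen_closed hp hn)
qed

lemma patch_simps:
  "openin (pos_top X) U \<Longrightarrow> openin (patch X) U"
  "openin (neg_top X) U \<Longrightarrow> openin (patch X) U"
  "bispace X \<Longrightarrow> topspace (patch X) = points X"
  unfolding patch_def points_def bispace_def
  by (auto intro!: topology_generated_by_Basis dest: openin_subset)

lemma id_hom:
  assumes "\<And>U. openin S U \<Longrightarrow> openin T U" "topspace S = topspace T"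
  shows "(\<lambda>U. U) \<in> frame_hom (opens_frame S) (opens_frame T)"
  unfolding frame_hom_def
proof (intro CollectI conjI ballI allI impI)
  fix F assume F: "F \<subseteq> carrier (opens_frame S)"
  then have "F \<subseteq> {U. openin T U}" using assms(1) by auto
  then show "\<Squnion>\<^bsub>opens_frame S\<^esub> F = \<Squnion>\<^bsub>opens_frame T\<^esub> ((\<lambda>U. U) ` F)"
    using F by (simp add: opens_frame_sup)
qed (use assms in \<open>auto simp: opens_frame_top opens_frame_meet\<close>)

lemma Omega_fin_spatial:
  assumes "bispace X"
  obtains k where "k \<in> frame_hom (Omega_fin X) (opens_frame (patch X))"
    "\<And>U. openin (pos_top X) U \<Longrightarrow> k (pos_emb (bOmega_fin X) U) = U"
    "\<And>U. openin (neg_top X) U \<Longrightarrow> k (neg_emb (bOmega_fin X) U) = U"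
proof (rule Omega_fin_universal[OF frame_opens])
  have t: "topspace (pos_top X) = topspace (patch X)" "topspace (neg_top X) = topspace (patch X)"
    using patch_simps(3)[OF assms] assms by (simp_all add: points_def bispace_def)
  show "(\<lambda>U. U) \<in> frame_hom (opens_frame (pos_top X)) (opens_frame (patch X))"
    "(\<lambda>U. U) \<in> frame_hom (opens_frame (neg_top X)) (opens_frame (patch X))"
    using t by (auto intro!: id_hom intro: patch_simps)
  fix U U' V V' assume o: "openin (pos_top X) U" "openin (neg_top X) U'"
      "openin (pos_top X) V" "openin (neg_top X) V'" "U \<inter> U' \<subseteq> V \<union> V'"
  have "V \<squnion>\<^bsub>opens_frame (patch X)\<^esub> V' = V \<union> V'"
    unfolding join_def using o by (subst opens_frame_sup) (auto intro: patch_simps)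
  then show "U \<sqinter>\<^bsub>opens_frame (patch X)\<^esub> U' \<sqsubseteq>\<^bsub>opens_frame (patch X)\<^esub> V \<squnion>\<^bsub>opens_frame (patch X)\<^esub> V'"
    using o by (simp add: opens_frame_meet patch_simps)
qed (use that in blast)

theorem biframe_bOmega_fin:
  assumes "bispace X" shows "biframe (bOmega_fin X)"
  unfolding biframe_def
proof (intro conjI ballI)
  obtain k where k: "\<And>U. openin (pos_top X) U \<Longrightarrow> k (pos_emb (bOmega_fin X) U) = U"
    "\<And>U. openin (neg_top X) U \<Longrightarrow> k (neg_emb (bOmega_fin X) U) = U"
    using Omega_fin_spatial[OF assms] by metis
  show "inj_on (pos_emb (bOmega_fin X)) (carrier (pos (bOmega_fin X)))"
    using k(1) by (intro inj_on_inverseI[of _ k]) simp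
  show "inj_on (neg_emb (bOmega_fin X)) (carrier (neg (bOmega_fin X)))"
    using k(2) by (intro inj_on_inverseI[of _ k]) simp
  interpret C: frame "opens_coprod X" by (rule frame_opens_coprod)
  fix A assume "A \<in> carrier (main (bOmega_fin X))"
  then obtain D where D: "D \<in> carrier (opens_coprod X)" "A = fin_congruence X `` {D}"
    using frame_with_congruence.Q_simps(1)[OF fwc, of X] frame_with_congruence.Q_cases[OF fwc, of A X]
    by (auto simp: Omega_fin_def)
  then have CD: "C_ideal (opens_frame (pos_top X)) (opens_frame (neg_top X)) D"
    by (simp add: opens_coprod_def)
  have Ds: "D \<subseteq> carrier (pos (bOmega_fin X)) \<times> carrier (neg (bOmega_fin X))"
    using C_idealD(1)[OF CD] by simp
  let ?F = "(\<lambda>(a, b). gen_pos X a \<sqinter>\<^bsub>opens_coprod X\<^esub> gen_neg X b) ` D"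
  have FC: "?F \<subseteq> carrier (opens_coprod X)"
    using Ds by (auto intro!: C.meet_closed gen_closed)
  have "D = \<Squnion>\<^bsub>opens_coprod X\<^esub> ?F"
    using two_frames.coprod_generated[OF opens_two CD]
    by (simp add: gen_pos_def gen_neg_def opens_coprod_def)
  then have "A = \<Squnion>\<^bsub>Omega_fin X\<^esub> ((\<lambda>a. fin_congruence X `` {a}) ` ?F)"
    using D(2) frame_homD(4)[OF q_hom' FC] by simp
  also have "(\<lambda>a. fin_congruence X `` {a}) ` ?F =
     (\<lambda>(a, b). pos_emb (bOmega_fin X) a \<sqinter>\<^bsub>main (bOmega_fin X)\<^esub> neg_emb (bOmega_fin X) b) ` D"
    unfolding image_image
  proof (rule image_cong[OF refl])
    fix p assume "p \<in> D"
    then obtain a b where "p = (a, b)" "openin (pos_top X) a" "openin (neg_top X) b"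
      using Ds by (cases p) auto
    then show "fin_congruence X `` {case p of (a, b) \<Rightarrow> gen_pos X a \<sqinter>\<^bsub>opens_coprod X\<^esub> gen_neg X b} =
       (case p of (a, b) \<Rightarrow> pos_emb (bOmega_fin X) a \<sqinter>\<^bsub>main (bOmega_fin X)\<^esub> neg_emb (bOmega_fin X) b)"
      using frame_homD(3)[OF q_hom', of "gen_pos X a" X "gen_neg X b"] by (simp add: gen_closed)
  qed
  finally show "\<exists>S\<subseteq>carrier (pos (bOmega_fin X)) \<times> carrier (neg (bOmega_fin X)).
      A = \<Squnion>\<^bsub>main (bOmega_fin X)\<^esub> ((\<lambda>(a, b). pos_emb (bOmega_fin X) a \<sqinter>\<^bsub>main (bOmega_fin X)\<^esub> neg_emb (bOmega_fin X) b) ` S)"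
    using Ds by (intro exI[of _ D]) simp
qed (use frame_opens frame_Omega_fin pos_emb_hom neg_emb_hom in \<open>simp_all del: bOmega_fin_simps(4,5)\<close>)

lemma preimage_hom:
  assumes "continuous_map S T f"
  shows "(\<lambda>U. f -` U \<inter> topspace S) \<in> frame_hom (opens_frame T) (opens_frame S)"
proof -
  have o: "openin S (f -` U \<inter> topspace S)" if "openin T U" for U
    using openin_continuous_map_preimage[OF assms that] by (simp add: vimage_def Int_def conj_commute)
  show ?thesis
    unfolding frame_hom_def
  proof (intro CollectI conjI ballI allI impI)
    show "f -` \<top>\<^bsub>opens_frame T\<^esub> \<inter> topspace S = \<top>\<^bsub>opens_frame S\<^esub>"
      using continuous_map_image_subset_topspace[OF assms] by (auto simp: opens_frame_top)
    fix F assume F: "F \<subseteq> carrier (opens_frame T)"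
    then have "(\<lambda>U. f -` U \<inter> topspace S) ` F \<subseteq> {U. openin S U}" using o by auto
    then show "f -` (\<Squnion>\<^bsub>opens_frame T\<^esub> F) \<inter> topspace S = \<Squnion>\<^bsub>opens_frame S\<^esub> ((\<lambda>U. f -` U \<inter> topspace S) ` F)"
      using F by (simp add: opens_frame_sup) blast
  qed (use o in \<open>auto simp: opens_frame_meet\<close>)
qed

theorem biframe_map_bOmega_fin_map:
  assumes "bispace X" "bispace Y" "bicontinuous Y X f"
  shows "biframe_map (bOmega_fin X) (bOmega_fin Y) (bOmega_fin_map Y f)"
  unfolding biframe_map_def
proof (intro conjI biframe_bOmega_fin assms)
  have p: "points Y = topspace (pos_top Y)" "points Y = topspace (neg_top Y)"
    using assms(2) by (auto simp: points_def bispace_def)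
  let ?p = "\<lambda>U. f -` U \<inter> points Y"
  have 1: "?p \<in> frame_hom (opens_frame (pos_top X)) (opens_frame (pos_top Y))"
    using assms(3) unfolding p(1) bicontinuous_def by (intro preimage_hom) simp
  have 2: "?p \<in> frame_hom (opens_frame (neg_top X)) (opens_frame (neg_top Y))"
    using assms(3) unfolding p(2) bicontinuous_def by (intro preimage_hom) simp
  show "fst (bOmega_fin_map Y f) \<in> frame_hom (pos (bOmega_fin X)) (pos (bOmega_fin Y))"
    "snd (bOmega_fin_map Y f) \<in> frame_hom (neg (bOmega_fin X)) (neg (bOmega_fin Y))"
    using 1 2 by (simp_all add: bOmega_fin_map_def)
  have o1: "openin (pos_top Y) (?p U)" if "openin (pos_top X) U" for U
    using frame_homD(1)[OF 1] that by auto
  have o2: "openin (neg_top Y) (?p U)" if "openin (neg_top X) U" for U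
    using frame_homD(1)[OF 2] that by auto
  obtain k where k: "k \<in> frame_hom (Omega_fin X) (Omega_fin Y)"
    "\<And>U. openin (pos_top X) U \<Longrightarrow> k (pos_emb (bOmega_fin X) U) = pos_emb (bOmega_fin Y) (?p U)"
    "\<And>U. openin (neg_top X) U \<Longrightarrow> k (neg_emb (bOmega_fin X) U) = neg_emb (bOmega_fin Y) (?p U)"
  proof (rule Omega_fin_universal[OF frame_Omega_fin frame_hom_comp[OF 1 pos_emb_hom] frame_hom_comp[OF 2 neg_emb_hom]])
    fix U U' V V' assume o: "openin (pos_top X) U" "openin (neg_top X) U'"
      "openin (pos_top X) V" "openin (neg_top X) V'" "U \<inter> U' \<subseteq> V \<union> V'"
    show "pos_emb (bOmega_fin Y) (?p U) \<sqinter>\<^bsub>Omega_fin Y\<^esub> neg_emb (bOmega_fin Y) (?p U')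
       \<sqsubseteq>\<^bsub>Omega_fin Y\<^esub> pos_emb (bOmega_fin Y) (?p V) \<squnion>\<^bsub>Omega_fin Y\<^esub> neg_emb (bOmega_fin Y) (?p V')"
      using o by (intro Omega_fin_relation o1 o2) auto
  qed (use that in blast)
  show "\<exists>h. is_main_component (bOmega_fin X) (bOmega_fin Y) (bOmega_fin_map Y f) h"
    using k unfolding is_main_component_def
    by (intro exI[of _ k]) (simp add: bOmega_fin_map_def del: bOmega_fin_simps(4,5))
qed

lemma biframeD:
  assumes "biframe \<L>"
  shows "a \<in> carrier (pos \<L>) \<Longrightarrow> pos_emb \<L> a \<in> carrier (main \<L>)"
    "b \<in> carrier (neg \<L>) \<Longrightarrow> neg_emb \<L> b \<in> carrier (main \<L>)"
    "c \<in> carrier (main \<L>) \<Longrightarrow> \<exists>S \<subseteq> carrier (pos \<L>) \<times> carrier (neg \<L>).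
        c = \<Squnion>\<^bsub>main \<L>\<^esub> ((\<lambda>(a, b). pos_emb \<L> a \<sqinter>\<^bsub>main \<L>\<^esub> neg_emb \<L> b) ` S)"
proof -
  have "pos_emb \<L> \<in> frame_hom (pos \<L>) (main \<L>)" "neg_emb \<L> \<in> frame_hom (neg \<L>) (main \<L>)"
    using assms by (simp_all add: biframe_def)
  from frame_homD(1)[OF this(1)] frame_homD(1)[OF this(2)]
  show "a \<in> carrier (pos \<L>) \<Longrightarrow> pos_emb \<L> a \<in> carrier (main \<L>)"
    "b \<in> carrier (neg \<L>) \<Longrightarrow> neg_emb \<L> b \<in> carrier (main \<L>)" by auto
qed (use assms in \<open>simp add: biframe_def\<close>)

lemma main_component_unique:
  assumes "biframe \<L>" "frame (main \<M>)"
    "is_main_component \<L> \<M> f h" "is_main_component \<L> \<M> f k" "c \<in> carrier (main \<L>)"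
  shows "h c = k c"
proof -
  interpret M: frame "main \<L>" using assms(1) by (simp add: biframe_def)
  obtain S where S: "S \<subseteq> carrier (pos \<L>) \<times> carrier (neg \<L>)"
    and c: "c = \<Squnion>\<^bsub>main \<L>\<^esub> ((\<lambda>(a, b). pos_emb \<L> a \<sqinter>\<^bsub>main \<L>\<^esub> neg_emb \<L> b) ` S)"
    using biframeD(3)[OF assms(1,5)] by (elim exE conjE)
  have pe: "pos_emb \<L> a \<in> carrier (main \<L>)" if "a \<in> carrier (pos \<L>)" for a
    using biframeD[OF assms(1)] that by simp
  have ne: "neg_emb \<L> a \<in> carrier (main \<L>)" if "a \<in> carrier (neg \<L>)" for a
    using biframeD[OF assms(1)] that by simp
  let ?F = "(\<lambda>(a, b). pos_emb \<L> a \<sqinter>\<^bsub>main \<L>\<^esub> neg_emb \<L> b) ` S"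
  have F: "?F \<subseteq> carrier (main \<L>)" using S pe ne by (auto intro!: M.meet_closed)
  have h: "h \<in> frame_hom (main \<L>) (main \<M>)" and k: "k \<in> frame_hom (main \<L>) (main \<M>)"
    using assms(3,4) by (auto simp: is_main_component_def)
  have "h ` ?F = k ` ?F"
    unfolding image_image
  proof (rule image_cong[OF refl])
    fix p assume "p \<in> S"
    then obtain a b where "p = (a, b)" "a \<in> carrier (pos \<L>)" "b \<in> carrier (neg \<L>)"
      using S by (cases p) auto
    then show "h (case p of (a, b) \<Rightarrow> pos_emb \<L> a \<sqinter>\<^bsub>main \<L>\<^esub> neg_emb \<L> b) =
       k (case p of (a, b) \<Rightarrow> pos_emb \<L> a \<sqinter>\<^bsub>main \<L>\<^esub> neg_emb \<L> b)"
      using assms(3,4) pe ne by (simp add: is_main_component_def frame_homD(3)[OF h] frame_homD(3)[OF k])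
  qed
  then show ?thesis unfolding c using frame_homD(4)[OF h F] frame_homD(4)[OF k F] by simp
qed

theorem main_component:
  assumes "biframe_map \<L> \<M> f"
  shows "main_component \<L> \<M> f \<in> extensional (carrier (main \<L>)) \<and>
    is_main_component \<L> \<M> f (main_component \<L> \<M> f)"
proof -
  have L: "biframe \<L>" and M: "frame (main \<M>)" using assms by (auto simp: biframe_map_def biframe_def)
  interpret L: frame "main \<L>" using L by (simp add: biframe_def)
  obtain h where h: "is_main_component \<L> \<M> f h" using assms by (auto simp: biframe_map_def)
  define k where "k = restrict h (carrier (main \<L>))"
  have hh: "h \<in> frame_hom (main \<L>) (main \<M>)" using h by (simp add: is_main_component_def)
  have "k \<in> frame_hom (main \<L>) (main \<M>)"
  proof -
    have "k ` S = h ` S" if "S \<subseteq> carrier (main \<L>)" for S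
      using that by (intro image_cong) (auto simp: k_def)
    then show ?thesis
      using frame_homD[OF hh] unfolding frame_hom_def
      by (intro CollectI conjI ballI allI impI) (simp_all add: k_def Pi_iff)
  qed
  moreover have "pos_emb \<L> a \<in> carrier (main \<L>)" if "a \<in> carrier (pos \<L>)" for a
    using biframeD[OF L] that by simp
  moreover have "neg_emb \<L> a \<in> carrier (main \<L>)" if "a \<in> carrier (neg \<L>)" for a
    using biframeD[OF L] that by simp
  ultimately have k: "is_main_component \<L> \<M> f k"
    using h by (simp add: is_main_component_def k_def)
  have "\<exists>!h. h \<in> extensional (carrier (main \<L>)) \<and> is_main_component \<L> \<M> f h"
  proof (rule ex1I[of _ k])
    show "k \<in> extensional (carrier (main \<L>)) \<and> is_main_component \<L> \<M> f k"
      using k by (simp add: k_def)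
    fix g assume "g \<in> extensional (carrier (main \<L>)) \<and> is_main_component \<L> \<M> f g"
    then show "g = k"
      using main_component_unique[OF L M _ k] by (intro extensionalityI[of _ "carrier (main \<L>)"]) (auto simp: k_def)
  qed
  from theI'[OF this] show ?thesis unfolding main_component_def .
qed

lemma bispace_bisubspace: "bispace X \<Longrightarrow> bispace (bisubspace X Y)"
  by (simp add: bispace_def bisubspace_def)

lemma points_bisubspace: "Y \<subseteq> points X \<Longrightarrow> points (bisubspace X Y) = Y"
  by (auto simp: points_def bisubspace_def)

lemma bicontinuous_inclusion: "bicontinuous (bisubspace X Y) X id"
  by (simp add: bicontinuous_def bisubspace_def)

theorem biframe_map_bisubspace:
  assumes "bispace X"
  shows "biframe_map (bOmega_fin X) (bOmega_fin (bisubspace X Y)) (bOmega_fin_map (bisubspace X Y) id)"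
  using assms by (intro biframe_map_bOmega_fin_map bispace_bisubspace bicontinuous_inclusion)

end

theory Submission
  imports Defs
begin

text \<open>
  All four conditions are compared with the inclusions \<open>U \<inter> U' \<subseteq> V \<union> V'\<close> between opens. Such an
  inclusion can be read off from \<open>\<Omega>\<^sub>f\<^sub>i\<^sub>n(X)\<close>, because the latter maps to the opens of the patch, so the
  biquotient of \<open>Y\<close> knows precisely which of them hold in \<open>Y\<close>. If all those which hold in \<open>Y\<close> hold
  in \<open>X\<close>, then restriction to \<open>Y\<close> is bijective on opens, and the universal property of \<open>\<Omega>\<^sub>f\<^sub>i\<^sub>n(Y)\<close>
  turns the inverse into a biframe map. For \<open>Y = X - {x}\<close>, an inclusion that holds in \<open>Y\<close> but not in
  \<open>X\<close> amounts to a presentation \<open>{x} = U \<inter> U' \<inter> (X - V) \<inter> (X - V')\<close>.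
\<close>

section \<open>Inclusions between opens and the order of \<open>Omega_fin X\<close>\<close>

text \<open>Equivalently, every nonempty set \<open>U \<inter> U' - (V \<union> V')\<close> meets
  \<open>Y\<close>. As these sets form a base of the patch of \<open>Sk X\<close>, this is density
  of \<open>Y\<close> in that space, phrased so that it matches the relations of
  \<open>Omega_fin\<close>.\<close>

definition bidense :: "'a bispace \<Rightarrow> 'a set \<Rightarrow> bool" where
  "bidense X Y \<longleftrightarrow>
     (\<forall>U U' V V'. openin (pos_top X) U \<and> openin (neg_top X) U' \<and>
        openin (pos_top X) V \<and> openin (neg_top X) V' \<and> U \<inter> U' \<inter> Y \<subseteq> V \<union> V' \<longrightarrow>
        U \<inter> U' \<subseteq> V \<union> V')"

lemma bidenseD:
  assumes "bidense X Y" "openin (pos_top X) U" "openin (neg_top X) U'"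
    "openin (pos_top X) V" "openin (neg_top X) V'" "U \<inter> U' \<inter> Y \<subseteq> V \<union> V'"
  shows "U \<inter> U' \<subseteq> V \<union> V'"
  using assms unfolding bidense_def by blast

text \<open>This element and \<open>upper_elt\<close> below are the two sides of the imposed
  relations, taken in the quotient.\<close>

abbreviation lower_elt :: "'a bispace \<Rightarrow> 'a set \<Rightarrow> 'a set \<Rightarrow> ('a set \<times> 'a set) set set" where
  "lower_elt X U U' \<equiv> pos_emb (bOmega_fin X) U \<sqinter>\<^bsub>Omega_fin X\<^esub> neg_emb (bOmega_fin X) U'"

abbreviation upper_elt :: "'a bispace \<Rightarrow> 'a set \<Rightarrow> 'a set \<Rightarrow> ('a set \<times> 'a set) set set" where
  "upper_elt X V V' \<equiv> pos_emb (bOmega_fin X) V \<squnion>\<^bsub>Omega_fin X\<^esub> neg_emb (bOmega_fin X) V'"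

lemma emb_closed:
  "openin (pos_top X) U \<Longrightarrow> pos_emb (bOmega_fin X) U \<in> carrier (Omega_fin X)"
  "openin (neg_top X) U' \<Longrightarrow> neg_emb (bOmega_fin X) U' \<in> carrier (Omega_fin X)"
  using frame_homD(1)[OF pos_emb_hom, of X] frame_homD(1)[OF neg_emb_hom, of X]
  by (auto simp del: bOmega_fin_simps)

lemma elt_closed:
  assumes "openin (pos_top X) U" "openin (neg_top X) U'"
  shows "lower_elt X U U' \<in> carrier (Omega_fin X)" "upper_elt X U U' \<in> carrier (Omega_fin X)"
proof -
  interpret frame "Omega_fin X" by (rule frame_Omega_fin)
  show "lower_elt X U U' \<in> carrier (Omega_fin X)" "upper_elt X U U' \<in> carrier (Omega_fin X)"
    using assms by (auto intro: meet_closed join_closed emb_closed simp del: bOmega_fin_simps)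
qed

text \<open>The relations force no inequality of this shape beyond those that hold for sets: the
  frame map to the opens of the patch sends the formal meet and join to the actual intersection and
  union.\<close>

lemma Omega_fin_le_iff:
  assumes X: "bispace X" and o: "openin (pos_top X) U" "openin (neg_top X) U'"
    "openin (pos_top X) V" "openin (neg_top X) V'"
  shows "lower_elt X U U' \<sqsubseteq>\<^bsub>Omega_fin X\<^esub> upper_elt X V V' \<longleftrightarrow> U \<inter> U' \<subseteq> V \<union> V'"
proof
  assume le: "lower_elt X U U' \<sqsubseteq>\<^bsub>Omega_fin X\<^esub> upper_elt X V V'"
  obtain k where k: "k \<in> frame_hom (Omega_fin X) (opens_frame (patch X))"
    and kp: "\<And>U. openin (pos_top X) U \<Longrightarrow> k (pos_emb (bOmega_fin X) U) = U"
    and kn: "\<And>U. openin (neg_top X) U \<Longrightarrow> k (neg_emb (bOmega_fin X) U) = U"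
    using Omega_fin_spatial[OF X] by metis
  have "k (lower_elt X U U') \<subseteq> k (upper_elt X V V')"
    using frame_hom_mono[OF frame_Omega_fin frame_opens k elt_closed(1)[OF o(1,2)]
        elt_closed(2)[OF o(3,4)] le] by simp
  moreover have "k (lower_elt X U U') = U \<inter> U'"
    by (simp only: frame_homD(3)[OF k emb_closed(1)[OF o(1)] emb_closed(2)[OF o(2)]] kp[OF o(1)]
        kn[OF o(2)] opens_frame_meet patch_simps o)
  moreover have "k (upper_elt X V V') = \<Union>{V, V'}"
    unfolding frame_hom_join[OF k emb_closed(1)[OF o(3)] emb_closed(2)[OF o(4)]] kp[OF o(3)] kn[OF o(4)]
    unfolding join_def by (rule opens_frame_sup) (auto intro: patch_simps o)
  ultimately show "U \<inter> U' \<subseteq> V \<union> V'" by simp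
qed (rule Omega_fin_relation[OF o])

section \<open>Invertible frame maps and biframe isomorphisms\<close>

text \<open>To see that \<open>g\<close> preserves an operation, apply \<open>h\<close> to the
  operation on the values of \<open>g\<close>, use that \<open>h\<close> preserves it, and cancel
  with \<open>g\<close>.\<close>

lemma frame_hom_inverse:
  assumes L: "frame L" and h: "h \<in> frame_hom L M" and g: "g \<in> carrier M \<rightarrow> carrier L"
    and gh: "\<And>a. a \<in> carrier L \<Longrightarrow> g (h a) = a" and hg: "\<And>b. b \<in> carrier M \<Longrightarrow> h (g b) = b"
  shows "g \<in> frame_hom M L"
proof -
  interpret frame L by (rule L)
  have "g (a \<sqinter>\<^bsub>M\<^esub> b) = g a \<sqinter>\<^bsub>L\<^esub> g b" if "a \<in> carrier M" "b \<in> carrier M" for a b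
  proof -
    have c: "g a \<in> carrier L" "g b \<in> carrier L" using g that by auto
    have "h (g a \<sqinter>\<^bsub>L\<^esub> g b) = a \<sqinter>\<^bsub>M\<^esub> b" using frame_homD(3)[OF h c] hg that by simp
    then show ?thesis using gh[OF meet_closed[OF c]] by simp
  qed
  moreover have "g (\<Squnion>\<^bsub>M\<^esub> S) = \<Squnion>\<^bsub>L\<^esub> (g ` S)" if S: "S \<subseteq> carrier M" for S
  proof -
    have c: "g ` S \<subseteq> carrier L" using g S by auto
    have "h ` g ` S = S" using hg S by (force simp: image_image)
    then have "h (\<Squnion>\<^bsub>L\<^esub> (g ` S)) = \<Squnion>\<^bsub>M\<^esub> S" using frame_homD(4)[OF h c] by simp
    then show ?thesis using gh[OF sup_closed[OF c]] by simp
  qed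
  moreover have "g \<top>\<^bsub>M\<^esub> = \<top>\<^bsub>L\<^esub>" using gh[OF top_closed] frame_homD(2)[OF h] by simp
  ultimately show ?thesis using g unfolding frame_hom_def by blast
qed

text \<open>An isomorphism is only required to be invertible on the positive and negative parts.
  Uniqueness of main components carries this over to the main part, where the main component of the
  inverse is a left inverse.\<close>

lemma biframe_iso_main_component_inj:
  assumes "biframe_iso \<L> \<M> f"
  shows "inj_on (main_component \<L> \<M> f) (carrier (main \<L>))"
proof -
  obtain g where f: "biframe_map \<L> \<M> f" and g: "biframe_map \<M> \<L> g"
    and gf: "\<And>a. a \<in> carrier (pos \<L>) \<Longrightarrow> fst g (fst f a) = a"
      "\<And>b. b \<in> carrier (neg \<L>) \<Longrightarrow> snd g (snd f b) = b"
    using assms unfolding biframe_iso_def by blast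
  define h where "h = main_component \<L> \<M> f"
  define k where "k = main_component \<M> \<L> g"
  have h: "is_main_component \<L> \<M> f h" and k: "is_main_component \<M> \<L> g k"
    using main_component[OF f] main_component[OF g] by (simp_all add: h_def k_def)
  have L: "biframe \<L>" and fc: "fst f \<in> carrier (pos \<L>) \<rightarrow> carrier (pos \<M>)"
    "snd f \<in> carrier (neg \<L>) \<rightarrow> carrier (neg \<M>)"
    using f by (auto simp: biframe_map_def intro!: frame_homD(1))
  \<comment> \<open>The pair \<open>(id, id)\<close> can stand for the composite, since only values
    on the two carriers matter and there the composite is the identity.\<close>
  have kh: "is_main_component \<L> \<L> (id, id) (\<lambda>c. k (h c))"
    using h k gf fc unfolding is_main_component_def
    by (auto intro: frame_hom_comp simp: Pi_iff)
  have id: "is_main_component \<L> \<L> (id, id) (\<lambda>c. c)"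
    by (auto simp: is_main_component_def frame_hom_def)
  have "frame (main \<L>)" using L by (simp add: biframe_def)
  then have "k (h c) = c" if "c \<in> carrier (main \<L>)" for c
    by (rule main_component_unique[OF L _ kh id that])
  then show ?thesis unfolding h_def[symmetric] by (rule inj_on_inverseI)
qed

section \<open>Restriction to a bisubspace and its biquotient\<close>

lemma restriction_simps:
  assumes "openin (pos_top X) U \<or> openin (neg_top X) U" "bispace X"
  shows "fst (bOmega_fin_map (bisubspace X Y) id) U = U \<inter> Y"
    "snd (bOmega_fin_map (bisubspace X Y) id) U = U \<inter> Y"
  using assms openin_subset[of "pos_top X" U] openin_subset[of "neg_top X" U]
  by (auto simp: bOmega_fin_map_def points_def bisubspace_def bispace_def)

lemma openin_bisubspace:
  "openin (pos_top (bisubspace X Y)) W \<longleftrightarrow> (\<exists>U. openin (pos_top X) U \<and> W = U \<inter> Y)"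
  "openin (neg_top (bisubspace X Y)) W \<longleftrightarrow> (\<exists>U. openin (neg_top X) U \<and> W = U \<inter> Y)"
  by (auto simp: bisubspace_def openin_subtopology)

text \<open>An inequality is coded as the equation "meet = lower element", so membership in the
  kernel becomes an inequality between images. The main component sends generators to their traces
  on \<open>Y\<close>, and \<open>Omega_fin_le_iff\<close> is then applied in the
  bisubspace.\<close>

lemma biquotient_mem_iff:
  assumes X: "bispace X" and o: "openin (pos_top X) U" "openin (neg_top X) U'"
    "openin (pos_top X) V" "openin (neg_top X) V'"
  shows "(lower_elt X U U' \<sqinter>\<^bsub>Omega_fin X\<^esub> upper_elt X V V', lower_elt X U U') \<in> biquotient X Y
    \<longleftrightarrow> U \<inter> U' \<inter> Y \<subseteq> V \<union> V'"
proof -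
  let ?Y = "bisubspace X Y"
  define h where "h = main_component (bOmega_fin X) (bOmega_fin ?Y) (bOmega_fin_map ?Y id)"
  have m: "is_main_component (bOmega_fin X) (bOmega_fin ?Y) (bOmega_fin_map ?Y id) h"
    using main_component[OF biframe_map_bisubspace[OF X]] by (simp add: h_def)
  then have h: "h \<in> frame_hom (Omega_fin X) (Omega_fin ?Y)" by (simp add: is_main_component_def)
  have hp: "h (pos_emb (bOmega_fin X) W) = pos_emb (bOmega_fin ?Y) (W \<inter> Y)"
    if "openin (pos_top X) W" for W
    using m that restriction_simps(1)[of X W Y] X
    by (simp add: is_main_component_def del: bOmega_fin_simps(4,5))
  have hn: "h (neg_emb (bOmega_fin X) W) = neg_emb (bOmega_fin ?Y) (W \<inter> Y)"
    if "openin (neg_top X) W" for W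
    using m that restriction_simps(2)[of X W Y] X
    by (simp add: is_main_component_def del: bOmega_fin_simps(4,5))
  have oY: "openin (pos_top ?Y) (U \<inter> Y)" "openin (neg_top ?Y) (U' \<inter> Y)"
    "openin (pos_top ?Y) (V \<inter> Y)" "openin (neg_top ?Y) (V' \<inter> Y)"
    using o by (auto simp: openin_bisubspace)
  interpret A: frame "Omega_fin X" by (rule frame_Omega_fin)
  interpret B: frame "Omega_fin ?Y" by (rule frame_Omega_fin)
  note lo = elt_closed(1)[OF o(1,2)] and up = elt_closed(2)[OF o(3,4)]
  have hlo: "h (lower_elt X U U') = lower_elt ?Y (U \<inter> Y) (U' \<inter> Y)"
    by (simp only: frame_homD(3)[OF h emb_closed(1)[OF o(1)] emb_closed(2)[OF o(2)]] hp[OF o(1)] hn[OF o(2)])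
  have hup: "h (upper_elt X V V') = upper_elt ?Y (V \<inter> Y) (V' \<inter> Y)"
    by (simp only: frame_hom_join[OF h emb_closed(1)[OF o(3)] emb_closed(2)[OF o(4)]] hp[OF o(3)] hn[OF o(4)])
  have "(lower_elt X U U' \<sqinter>\<^bsub>Omega_fin X\<^esub> upper_elt X V V', lower_elt X U U') \<in> biquotient X Y
    \<longleftrightarrow> h (lower_elt X U U' \<sqinter>\<^bsub>Omega_fin X\<^esub> upper_elt X V V') = h (lower_elt X U U')"
    unfolding biquotient_def Let_def h_def[symmetric] using A.meet_closed[OF lo up] lo
    by (simp del: bOmega_fin_simps)
  also have "\<dots> \<longleftrightarrow> lower_elt ?Y (U \<inter> Y) (U' \<inter> Y) \<sqsubseteq>\<^bsub>Omega_fin ?Y\<^esub> upper_elt ?Y (V \<inter> Y) (V' \<inter> Y)"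
    unfolding B.le_iff_meet[OF elt_closed(1)[OF oY(1,2)] elt_closed(2)[OF oY(3,4)]]
    by (simp only: frame_homD(3)[OF h lo up] hlo hup)
  also have "\<dots> \<longleftrightarrow> U \<inter> U' \<inter> Y \<subseteq> V \<union> V'"
    unfolding Omega_fin_le_iff[OF bispace_bisubspace[OF X] oY] by blast
  finally show ?thesis .
qed

lemma biquotient_of_iso:
  assumes "biframe_iso (bOmega_fin X) (bOmega_fin (bisubspace X Y)) (bOmega_fin_map (bisubspace X Y) id)"
  shows "biquotient X Y = Id_on (carrier (Omega_fin X))"
  using biframe_iso_main_component_inj[OF assms]
  by (auto simp: biquotient_def Let_def inj_on_def)

text \<open>An inclusion that holds on \<open>Y\<close> gives a pair of the congruence. If the
  congruence is the diagonal, the pair is an equation in \<open>Omega_fin X\<close>, from which the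
  inclusion on all of \<open>X\<close> is read off.\<close>

lemma bidense_of_biquotient:
  assumes X: "bispace X" and q: "biquotient X Y = Id_on (carrier (Omega_fin X))"
  shows "bidense X Y"
  unfolding bidense_def
proof (intro allI impI, elim conjE)
  fix U U' V V' assume o: "openin (pos_top X) U" "openin (neg_top X) U'"
      "openin (pos_top X) V" "openin (neg_top X) V'" and "U \<inter> U' \<inter> Y \<subseteq> V \<union> V'"
  interpret frame "Omega_fin X" by (rule frame_Omega_fin)
  have "(lower_elt X U U' \<sqinter>\<^bsub>Omega_fin X\<^esub> upper_elt X V V', lower_elt X U U') \<in> biquotient X Y"
    unfolding biquotient_mem_iff[OF X o] by fact
  then have "lower_elt X U U' \<sqinter>\<^bsub>Omega_fin X\<^esub> upper_elt X V V' = lower_elt X U U'"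
    unfolding q by (rule Id_onE) (simp del: bOmega_fin_simps)
  then show "U \<inter> U' \<subseteq> V \<union> V'"
    using le_iff_meet[OF elt_closed(1)[OF o(1,2)] elt_closed(2)[OF o(3,4)]] Omega_fin_le_iff[OF X o]
    by blast
qed

text \<open>Opens of the bisubspace are traces, and bidensity makes the open with a given trace
  unique, so restriction is bijective on each part. It also lifts the mixed inclusions, as the
  universal property of \<open>Omega_fin\<close> demands of the inverse.\<close>

lemma biframe_iso_of_bidense:
  assumes X: "bispace X" and d: "bidense X Y"
  shows "biframe_iso (bOmega_fin X) (bOmega_fin (bisubspace X Y)) (bOmega_fin_map (bisubspace X Y) id)"
proof -
  let ?Y = "bisubspace X Y"
  let ?f = "bOmega_fin_map ?Y id"
  have f: "biframe_map (bOmega_fin X) (bOmega_fin ?Y) ?f" by (rule biframe_map_bisubspace[OF X])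
  have t: "openin (pos_top X) (points X)" "openin (neg_top X) (points X)"
    using X openin_topspace unfolding points_def bispace_def by metis+
  have sub: "U \<subseteq> points X" if "openin (pos_top X) U \<or> openin (neg_top X) U" for U
    using that X openin_subset by (fastforce simp: points_def bispace_def)
  \<comment> \<open>Opens of a single topology are compared by taking the whole space and
    \<open>{}\<close> as the two opens of the other topology.\<close>
  have mono: "U \<subseteq> V" if "openin (pos_top X) U \<and> openin (pos_top X) V \<or> openin (neg_top X) U \<and> openin (neg_top X) V"
    "U \<inter> Y \<subseteq> V" for U V
    using that(1)
  proof (elim disjE conjE)
    assume "openin (pos_top X) U" "openin (pos_top X) V"
    then show ?thesis using bidenseD[OF d _ t(2), of U V "{}"] that(2) sub[of U] by auto
  next
    assume "openin (neg_top X) U" "openin (neg_top X) V"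
    then show ?thesis using bidenseD[OF d t(1), of U "{}" V] that(2) sub[of U] by auto
  qed
  have eq: "U = V" if "openin (pos_top X) U \<and> openin (pos_top X) V \<or> openin (neg_top X) U \<and> openin (neg_top X) V"
    "U \<inter> Y = V \<inter> Y" for U V
    using mono[of U V] mono[of V U] that by blast
  \<comment> \<open>Any extension of \<open>W\<close> may be chosen, because \<open>eq\<close>
    leaves only one.\<close>
  define gp where "gp W = (SOME U. openin (pos_top X) U \<and> W = U \<inter> Y)" for W
  define gn where "gn W = (SOME U. openin (neg_top X) U \<and> W = U \<inter> Y)" for W
  have gp: "openin (pos_top X) (gp W)" "gp W \<inter> Y = W" if "openin (pos_top ?Y) W" for W
    using someI_ex[OF that[unfolded openin_bisubspace]] by (simp_all add: gp_def)
  have gn: "openin (neg_top X) (gn W)" "gn W \<inter> Y = W" if "openin (neg_top ?Y) W" for W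
    using someI_ex[OF that[unfolded openin_bisubspace]] by (simp_all add: gn_def)
  have fgp: "fst ?f (gp W) = W" if "openin (pos_top ?Y) W" for W
    using gp[OF that] restriction_simps(1)[OF _ X] by simp
  have fgn: "snd ?f (gn W) = W" if "openin (neg_top ?Y) W" for W
    using gn[OF that] restriction_simps(2)[OF _ X] by simp
  have gfp: "gp (fst ?f U) = U" if "openin (pos_top X) U" for U
    unfolding restriction_simps(1)[OF disjI1[OF that] X]
    by (rule eq) (use gp[of "U \<inter> Y"] that openin_bisubspace(1)[of X Y "U \<inter> Y"] in auto)
  have gfn: "gn (snd ?f U) = U" if "openin (neg_top X) U" for U
    unfolding restriction_simps(2)[OF disjI2[OF that] X]
    by (rule eq) (use gn[of "U \<inter> Y"] that openin_bisubspace(2)[of X Y "U \<inter> Y"] in auto)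
  have hom: "fst ?f \<in> frame_hom (opens_frame (pos_top X)) (opens_frame (pos_top ?Y))"
    "snd ?f \<in> frame_hom (opens_frame (neg_top X)) (opens_frame (neg_top ?Y))"
    using f by (simp_all add: biframe_map_def)
  have gp_hom: "gp \<in> frame_hom (opens_frame (pos_top ?Y)) (opens_frame (pos_top X))"
    by (rule frame_hom_inverse[OF frame_opens hom(1)]) (auto simp: gp fgp gfp)
  have gn_hom: "gn \<in> frame_hom (opens_frame (neg_top ?Y)) (opens_frame (neg_top X))"
    by (rule frame_hom_inverse[OF frame_opens hom(2)]) (auto simp: gn fgn gfn)
  obtain k where k: "k \<in> frame_hom (Omega_fin ?Y) (Omega_fin X)"
    "\<And>U. openin (pos_top ?Y) U \<Longrightarrow> k (pos_emb (bOmega_fin ?Y) U) = pos_emb (bOmega_fin X) (gp U)"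
    "\<And>U. openin (neg_top ?Y) U \<Longrightarrow> k (neg_emb (bOmega_fin ?Y) U) = neg_emb (bOmega_fin X) (gn U)"
  proof (rule Omega_fin_universal[OF frame_Omega_fin frame_hom_comp[OF gp_hom pos_emb_hom]
        frame_hom_comp[OF gn_hom neg_emb_hom]])
    fix U U' V V' assume o: "openin (pos_top ?Y) U" "openin (neg_top ?Y) U'"
      "openin (pos_top ?Y) V" "openin (neg_top ?Y) V'" "U \<inter> U' \<subseteq> V \<union> V'"
    \<comment> \<open>Bidensity is needed here for positive and negative opens together: the
      relation on \<open>Y\<close> is the trace of this inclusion.\<close>
    have "gp U \<inter> gn U' \<subseteq> gp V \<union> gn V'"
      by (rule bidenseD[OF d gp(1)[OF o(1)] gn(1)[OF o(2)] gp(1)[OF o(3)] gn(1)[OF o(4)]])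
        (use gp(2)[OF o(1)] gn(2)[OF o(2)] gp(2)[OF o(3)] gn(2)[OF o(4)] o(5) in blast)
    then show "lower_elt X (gp U) (gn U') \<sqsubseteq>\<^bsub>Omega_fin X\<^esub> upper_elt X (gp V) (gn V')"
      by (intro Omega_fin_relation gp gn o)
  qed (use that in blast)
  have "is_main_component (bOmega_fin ?Y) (bOmega_fin X) (gp, gn) k"
    using k by (simp add: is_main_component_def del: bOmega_fin_simps(4,5))
  then have g: "biframe_map (bOmega_fin ?Y) (bOmega_fin X) (gp, gn)"
    using gp_hom gn_hom biframe_bOmega_fin bispace_bisubspace X
    by (auto simp: biframe_map_def simp del: bOmega_fin_simps(4,5))
  show ?thesis
    unfolding biframe_iso_def
    by (intro conjI exI[of _ "(gp, gn)"] f g) (simp_all add: fgp fgn gfp gfn)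
qed

text \<open>This closes a cycle: an isomorphism has trivial biquotient, which gives bidensity, which
  gives an isomorphism.\<close>

lemma biframe_iso_iff_bidense:
  assumes "bispace X"
  shows "biframe_iso (bOmega_fin X) (bOmega_fin (bisubspace X Y)) (bOmega_fin_map (bisubspace X Y) id)
    \<longleftrightarrow> bidense X Y"
  using assms biframe_iso_of_bidense bidense_of_biquotient biquotient_of_iso by metis

lemma biquotient_of_bidense:
  "\<lbrakk>bispace X; bidense X Y\<rbrakk> \<Longrightarrow> biquotient X Y = Id_on (carrier (Omega_fin X))"
  by (intro biquotient_of_iso biframe_iso_of_bidense)

section \<open>Presentations of points\<close>

lemma bi_T_D_obtain:
  assumes "bi_T_D X" "x \<in> points X"
  obtains U U' V V' where "openin (pos_top X) U" "openin (neg_top X) U'"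
    "openin (pos_top X) V" "openin (neg_top X) V'"
    "{x} = U \<inter> U' \<inter> (points X - V) \<inter> (points X - V')"
  using bspec[OF assms(1)[unfolded bi_T_D_def] assms(2)] by (elim exE conjE) (rule that)

lemma bi_T_D_iff_not_bidense:
  assumes X: "bispace X"
  shows "bi_T_D X \<longleftrightarrow> (\<forall>x \<in> points X. \<not> bidense X (points X - {x}))"
proof -
  have "(\<exists>U V U' V'. openin (pos_top X) U \<and> openin (pos_top X) V \<and>
        openin (neg_top X) U' \<and> openin (neg_top X) V' \<and>
        {x} = U \<inter> U' \<inter> (points X - V) \<inter> (points X - V')) \<longleftrightarrow> \<not> bidense X (points X - {x})"
    if "x \<in> points X" for x
  proof -
    \<comment> \<open>The right-hand set is \<open>U \<inter> U' - (V \<union> V')\<close>, where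
      the inclusion fails. It is \<open>{x}\<close> exactly when it is nonempty and contains no
      other point.\<close>
    have e: "{x} = U \<inter> U' \<inter> (points X - V) \<inter> (points X - V') \<longleftrightarrow>
        U \<inter> U' \<inter> (points X - {x}) \<subseteq> V \<union> V' \<and> \<not> U \<inter> U' \<subseteq> V \<union> V'"
      if "openin (pos_top X) U" for U U' V V'
      using openin_subset[OF that] \<open>x \<in> points X\<close> unfolding points_def by blast
    show ?thesis
    proof
      assume "\<exists>U V U' V'. openin (pos_top X) U \<and> openin (pos_top X) V \<and>
        openin (neg_top X) U' \<and> openin (neg_top X) V' \<and>
        {x} = U \<inter> U' \<inter> (points X - V) \<inter> (points X - V')"
      then show "\<not> bidense X (points X - {x})" using e bidenseD by metis
    next
      assume "\<not> bidense X (points X - {x})"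
      then obtain U U' V V' where o: "openin (pos_top X) U" "openin (neg_top X) U'"
        "openin (pos_top X) V" "openin (neg_top X) V'"
        and "U \<inter> U' \<inter> (points X - {x}) \<subseteq> V \<union> V'" "\<not> U \<inter> U' \<subseteq> V \<union> V'"
        unfolding bidense_def by metis
      then show "\<exists>U V U' V'. openin (pos_top X) U \<and> openin (pos_top X) V \<and>
        openin (neg_top X) U' \<and> openin (neg_top X) V' \<and>
        {x} = U \<inter> U' \<inter> (points X - V) \<inter> (points X - V')"
        using e[OF o(1)] by metis
    qed
  qed
  then show ?thesis unfolding bi_T_D_def by simp
qed

section \<open>The patch of the Skula bispace\<close>

text \<open>The sets \<open>U \<inter> U' \<inter> (points X - V) \<inter> (points X - V')\<close>
  form a base of the patch of \<open>Sk X\<close>, and a singleton is open exactly when it belongs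
  to the base.\<close>

lemma bi_T_D_iff_discrete_Skula:
  assumes X: "bispace X"
  shows "bi_T_D X \<longleftrightarrow> patch (Sk X) = discrete_topology (points X)"
proof
  have tn: "topspace (neg_top X) = points X" and tp: "topspace (pos_top X) = points X"
    using X by (simp_all add: points_def bispace_def)
  have sk: "openin (patch (Sk X)) W" if "openin (pos_top X) W \<or> openin (neg_top X) W \<or>
      closedin (pos_top X) W \<or> closedin (neg_top X) W" for W
    using that unfolding patch_def Sk_def by (auto intro!: topology_generated_by_Basis)
  \<comment> \<open>\<open>N W\<close> says that \<open>W\<close> is a union of such basic
    sets.\<close>
  define N where "N W \<longleftrightarrow> (\<forall>x \<in> W. \<exists>U V U' V'. openin (pos_top X) U \<and> openin (pos_top X) V \<and>
      openin (neg_top X) U' \<and> openin (neg_top X) V' \<and>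
      x \<in> U \<inter> U' \<inter> (points X - V) \<inter> (points X - V') \<and>
      U \<inter> U' \<inter> (points X - V) \<inter> (points X - V') \<subseteq> W)" for W
  have N_Int: "N (A \<inter> B)" if A: "N A" and B: "N B" for A B
    unfolding N_def
  proof
    fix x assume x: "x \<in> A \<inter> B"
    obtain U V U' V' where 1: "openin (pos_top X) U" "openin (pos_top X) V"
      "openin (neg_top X) U'" "openin (neg_top X) V'"
      "x \<in> U \<inter> U' \<inter> (points X - V) \<inter> (points X - V')"
      "U \<inter> U' \<inter> (points X - V) \<inter> (points X - V') \<subseteq> A"
      using A x unfolding N_def by (meson IntD1)
    obtain P Q P' Q' where 2: "openin (pos_top X) P" "openin (pos_top X) Q"
      "openin (neg_top X) P'" "openin (neg_top X) Q'"
      "x \<in> P \<inter> P' \<inter> (points X - Q) \<inter> (points X - Q')"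
      "P \<inter> P' \<inter> (points X - Q) \<inter> (points X - Q') \<subseteq> B"
      using B x unfolding N_def by (meson IntD2)
    show "\<exists>U V U' V'. openin (pos_top X) U \<and> openin (pos_top X) V \<and>
      openin (neg_top X) U' \<and> openin (neg_top X) V' \<and>
      x \<in> U \<inter> U' \<inter> (points X - V) \<inter> (points X - V') \<and>
      U \<inter> U' \<inter> (points X - V) \<inter> (points X - V') \<subseteq> A \<inter> B"
      \<comment> \<open>Basic sets are closed under intersection: the opens are intersected and the
        removed opens united.\<close>
      by (rule exI[of _ "U \<inter> P"], rule exI[of _ "V \<union> Q"], rule exI[of _ "U' \<inter> P'"], rule exI[of _ "V' \<union> Q'"])
        (use 1 2 in auto)
  qed
  have N_generated: "N W" if S: "\<And>s. s \<in> S \<Longrightarrow> N s" and W: "openin (topology_generated_by S) W" for S W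
    using W unfolding openin_topology_generated_by_iff
  proof induction
    case (UN K)
    then show ?case unfolding N_def by (meson UnionE Union_upper order_trans)
  qed (use S N_Int in \<open>auto simp: N_def\<close>)
  have N_Basis: "N W" if "openin (pos_top X) W \<or> openin (neg_top X) W \<or>
      closedin (pos_top X) W \<or> closedin (neg_top X) W" for W
    unfolding N_def
  proof
    fix x assume x: "x \<in> W"
    have s: "W \<subseteq> points X"
      using that tn tp by (metis closedin_subset openin_subset)
    have o: "openin (pos_top X) (points X)" "openin (neg_top X) (points X)"
      using tn tp by (metis openin_topspace)+
    have c: "openin (pos_top X) (points X - W)" if "closedin (pos_top X) W"
      using that tp by (metis closedin_def)
    have c': "openin (neg_top X) (points X - W)" if "closedin (neg_top X) W"
      using that tn by (metis closedin_def)
    show "\<exists>U V U' V'. openin (pos_top X) U \<and> openin (pos_top X) V \<and>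
      openin (neg_top X) U' \<and> openin (neg_top X) V' \<and>
      x \<in> U \<inter> U' \<inter> (points X - V) \<inter> (points X - V') \<and>
      U \<inter> U' \<inter> (points X - V) \<inter> (points X - V') \<subseteq> W"
      \<comment> \<open>An open \<open>W\<close> is presented by itself with nothing removed, a
        closed \<open>W\<close> as the whole space with its complement removed.\<close>
      using that
    proof (elim disjE)
      assume "openin (pos_top X) W"
      then show ?thesis using x s o
        by (intro exI[of _ W] exI[of _ "{}"] exI[of _ "points X"]) auto
    next
      assume "openin (neg_top X) W"
      then show ?thesis using x s o
        by (intro exI[of _ "points X"] exI[of _ "{}"] exI[of _ W]) auto
    next
      assume "closedin (pos_top X) W"
      from c[OF this] show ?thesis using x s o
        by (intro exI[of _ "points X"] exI[of _ "points X - W"] exI[of _ "points X"] exI[of _ "{}"]) auto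
    next
      assume "closedin (neg_top X) W"
      from c'[OF this] show ?thesis using x s o
        by (intro exI[of _ "points X"] exI[of _ "{}"] exI[of _ "points X"] exI[of _ "points X - W"]) auto
    qed
  qed
  \<comment> \<open>The patch is generated by two topologies that are themselves generated, so
    \<open>N_generated\<close> is applied at both levels.\<close>
  have N: "N W" if "openin (patch (Sk X)) W" for W
  proof (rule N_generated[OF _ that[unfolded patch_def]])
    fix s assume "s \<in> {U. openin (pos_top (Sk X)) U} \<union> {U. openin (neg_top (Sk X)) U}"
    then show "N s"
    proof
      assume "s \<in> {U. openin (pos_top (Sk X)) U}"
      then show ?thesis
        by (intro N_generated[of "{U. openin (pos_top X) U} \<union> {C. closedin (neg_top X) C}" s])
          (auto simp: Sk_def intro: N_Basis)
    next
      assume "s \<in> {U. openin (neg_top (Sk X)) U}"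
      then show ?thesis
        by (intro N_generated[of "{U. openin (neg_top X) U} \<union> {C. closedin (pos_top X) C}" s])
          (auto simp: Sk_def intro: N_Basis)
    qed
  qed
  {
    assume D: "patch (Sk X) = discrete_topology (points X)"
    show "bi_T_D X"
      unfolding bi_T_D_def
    proof
      fix x assume "x \<in> points X"
      then have "N {x}" using D by (intro N) simp
      then show "\<exists>U V U' V'. openin (pos_top X) U \<and> openin (pos_top X) V \<and>
        openin (neg_top X) U' \<and> openin (neg_top X) V' \<and>
        {x} = U \<inter> U' \<inter> (points X - V) \<inter> (points X - V')"
        \<comment> \<open>A basic set that contains \<open>x\<close> and lies within
          \<open>{x}\<close> is equal to it.\<close>
        unfolding N_def by (elim ballE[of _ _ x] exE) (blast, simp)
    qed
  }
  {
    assume T: "bi_T_D X"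
    have cl: "closedin (pos_top X) (points X - V)" if "openin (pos_top X) V" for V
      using that tp by (metis closedin_topspace closedin_diff)
    have cl': "closedin (neg_top X) (points X - V)" if "openin (neg_top X) V" for V
      using that tn by (metis closedin_topspace closedin_diff)
    have "openin (patch (Sk X)) {x}" if x: "x \<in> points X" for x
    proof -
      obtain U V U' V' where "openin (pos_top X) U" "openin (pos_top X) V"
        "openin (neg_top X) U'" "openin (neg_top X) V'"
        "{x} = U \<inter> U' \<inter> (points X - V) \<inter> (points X - V')"
        using bi_T_D_obtain[OF T x] by metis
      then show ?thesis using sk cl cl' by (metis openin_Int)
    qed
    moreover have "topspace (patch (Sk X)) = points X"
    proof
      show "points X \<subseteq> topspace (patch (Sk X))"
        using sk[of "points X"] tp openin_topspace[of "pos_top X"] by (simp add: openin_subset)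
      show "topspace (patch (Sk X)) \<subseteq> points X"
        using N[OF openin_topspace] unfolding N_def by blast
    qed
    ultimately show "patch (Sk X) = discrete_topology (points X)"
      using discrete_topology_unique by metis
  }
qed

section \<open>Distinct bisubspaces and their biquotients\<close>

text \<open>A presentation of \<open>{x}\<close> tests membership: the inclusion it yields holds on
  \<open>Y\<close> exactly when \<open>x\<close> is not in \<open>Y\<close>, so the biquotient
  determines \<open>Y\<close>. Conversely, if \<open>points X - {x}\<close> is bidense, it induces
  the same trivial biquotient as \<open>points X\<close>.\<close>

lemma bi_T_D_iff_biquotients_distinct:
  assumes X: "bispace X"
  shows "bi_T_D X \<longleftrightarrow>
    (\<forall>Y Z. Y \<subseteq> points X \<and> Z \<subseteq> points X \<and> Y \<noteq> Z \<longrightarrow> biquotient X Y \<noteq> biquotient X Z)"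
proof (intro iffI allI impI)
  assume T: "bi_T_D X"
  \<comment> \<open>One inclusion suffices, as \<open>Y\<close> and \<open>Z\<close> may be
    exchanged.\<close>
  have sub: "Y \<subseteq> Z" if "Y \<subseteq> points X" "biquotient X Y = biquotient X Z" for Y Z
  proof
    fix x assume x: "x \<in> Y"
    then obtain U V U' V' where o: "openin (pos_top X) U" "openin (neg_top X) U'"
      "openin (pos_top X) V" "openin (neg_top X) V'"
      and e: "{x} = U \<inter> U' \<inter> (points X - V) \<inter> (points X - V')"
      using bi_T_D_obtain[OF T subsetD[OF \<open>Y \<subseteq> points X\<close>]] by metis
    have "\<not> U \<inter> U' \<inter> Y \<subseteq> V \<union> V'" using e x by blast
    then have "\<not> U \<inter> U' \<inter> Z \<subseteq> V \<union> V'"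
      unfolding biquotient_mem_iff[OF X o, symmetric] that(2) .
    then obtain z where z: "z \<in> U" "z \<in> U'" "z \<in> Z" "z \<notin> V" "z \<notin> V'" by blast
    moreover have "U \<subseteq> points X" using openin_subset[OF o(1)] by (simp add: points_def)
    ultimately have "z \<in> {x}" unfolding e by blast
    then show "x \<in> Z" using z(3) by simp
  qed
  fix Y Z assume "Y \<subseteq> points X \<and> Z \<subseteq> points X \<and> Y \<noteq> Z"
  then show "biquotient X Y \<noteq> biquotient X Z" using sub[of Y Z] sub[of Z Y] by blast
next
  assume D: "\<forall>Y Z. Y \<subseteq> points X \<and> Z \<subseteq> points X \<and> Y \<noteq> Z \<longrightarrow> biquotient X Y \<noteq> biquotient X Z"
  \<comment> \<open>The whole space supplies the second bisubspace with diagonal congruence.\<close>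
  have "bidense X (points X)"
    unfolding bidense_def
  proof (intro allI impI, elim conjE)
    fix U U' V V' assume U: "openin (pos_top X) U" and le: "U \<inter> U' \<inter> points X \<subseteq> V \<union> V'"
    show "U \<inter> U' \<subseteq> V \<union> V'" using openin_subset[OF U] le unfolding points_def by blast
  qed
  note full = biquotient_of_bidense[OF X this]
  show "bi_T_D X"
    unfolding bi_T_D_iff_not_bidense[OF X]
  proof (intro ballI notI)
    fix x assume "x \<in> points X" "bidense X (points X - {x})"
    then show False
      using biquotient_of_bidense[OF X, of "points X - {x}"] full
        D[rule_format, of "points X" "points X - {x}"] by auto
  qed
qed

theorem proposition5p9:
  fixes X :: "'a bispace"
  assumes "bispace X"
  shows
    "(bi_T_D X \<longleftrightarrow> patch (Sk X) = discrete_topology (points X)) \<and>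
     (bi_T_D X \<longleftrightarrow>
        (\<forall>Y Z. Y \<subseteq> points X \<and> Z \<subseteq> points X \<and> Y \<noteq> Z \<longrightarrow> biquotient X Y \<noteq> biquotient X Z)) \<and>
     (bi_T_D X \<longleftrightarrow>
        (\<forall>x \<in> points X.
           \<not> biframe_iso (bOmega_fin X) (bOmega_fin (bisubspace X (points X - {x})))
               (bOmega_fin_map (bisubspace X (points X - {x})) id)))"
  unfolding biframe_iso_iff_bidense[OF assms]
  by (intro conjI bi_T_D_iff_discrete_Skula bi_T_D_iff_biquotients_distinct bi_T_D_iff_not_bidense assms)

end
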